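(* Suppose Assumptions A1, A2, A3 (stated in the context) hold, and that: (i) for some $k_1,k_2>0$, $\|\phi(x)\|\le k_1e^{k_2|x|}$ for all $x\in\mathbb{R}$; (ii) there exists a number $L>0$ such that, for $S_L:=\{x\in\mathbb{R}:\|\phi(x)\|\le L\}$, $\liminf_{l\to+\infty}\frac{\ell(S_L\cap[-l,l])}{l}>0$, where $\ell$ denotes the Lebesgue measure. Then the least-squares estimator is strongly consistent in the closed-loop system described in the context; more precisely, $$\|\hat\theta_t-\theta\|^2=O(t^{-1/2})\quad\text{almost surely (as }t\to\infty).$$
   Context: Setting: $n\ge2$; $\theta=(\theta_1,\ldots,\theta_n)^\tau\in\mathbb{R}^n$ is an unknown (random) parameter vector; $\phi=(f_1,\ldots,f_n)^\tau:\mathbb{R}\to\mathbb{R}^n$ is a known measurable vector function, and $E\subset\mathbb{R}$ is an open set such that $f_j\in C^n(E)$ for $1\le j\le n$. $\|\cdot\|$ is the Euclidean norm. The system is $$y_{t+1}=\theta^\tau\phi(y_t)+u_t+w_{t+1},\quad t\ge0,$$ with initial condition $y_0\in\mathbb{R}$ arbitrary. Assumptions. A1: $\{w_t\}$ is an i.i.d. random sequence with $w_1\sim N(0,\sigma^2)$, $\sigma>0$. A2: $\theta\sim N(\theta_0,I_n)$ is independent of $\{w_t\}$. A3: $f_1,\ldots,f_n$ are linearly independent on $E$. Closed-loop system: with $\phi_t:=\phi(y_t)$, the least-squares (LS) estimate $\hat\theta_t$ and the matrices $P_t$ are defined by $\hat\theta_0=\theta_0$, $P_0=I_n$, $$\hat\theta_{t+1}=\hat\theta_t+\sigma^{-2}P_{t+1}\phi_t(y_{t+1}-u_t-\phi_t^\tau\hat\theta_t),\qquad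 P_{t+1}=P_t-(\sigma^2+\phi_t^\tau P_t\phi_t)^{-1}P_t\phi_t\phi_t^\tau P_t,$$ and the control is $u_t=-\hat\theta_t^\tau\phi_t$, $t\ge0$. A bound $O(\cdot)$ almost surely means with an almost surely finite, possibly random, constant. *)

theory Defs
  imports "HOL-Probability.Probability" "HOL-Library.Landau_Symbols"
begin

text \<open>The class \<open>C\<^sup>k(E)\<close>; intended for open \<open>E\<close>, where the values of the iterated derivatives
  on \<open>E\<close> depend only on the values of \<open>f\<close> on \<open>E\<close>. Continuity of the derivatives of order
  below \<open>k\<close> follows from their differentiability.\<close>

definition C_k_on :: "nat \<Rightarrow> real set \<Rightarrow> (real \<Rightarrow> real) \<Rightarrow> bool" where
  "C_k_on k E f \<longleftrightarrow>
     (\<forall>j<k. \<forall>x\<in>E. (deriv ^^ j) f differentiable (at x)) \<and> continuous_on E ((deriv ^^ k) f)"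

definition lin_indep_on :: "real set \<Rightarrow> ('i::finite \<Rightarrow> real \<Rightarrow> real) \<Rightarrow> bool" where
  "lin_indep_on E f \<longleftrightarrow>
     (\<forall>c. (\<forall>x\<in>E. (\<Sum>i\<in>UNIV. c i * f i x) = 0) \<longrightarrow> (\<forall>i. c i = 0))"

text \<open>Lebesgue density of the multivariate normal law \<open>N(\<mu>, I\<^sub>n)\<close> on \<open>\<real>\<^sup>n\<close>, \<open>n = CARD('n)\<close>.\<close>

definition mvn_density :: "real ^ 'n::finite \<Rightarrow> real ^ 'n \<Rightarrow> real" where
  "mvn_density \<mu> x =
     (2 * pi) powr (- real CARD('n) / 2) * exp (- (norm (x - \<mu>))\<^sup>2 / 2)"

text \<open>Independence of two random elements that may take values in different types
  (\<^const>\<open>prob_space.indep_var\<close> requires a common type): the generated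
  \<open>\<sigma>\<close>-algebras are independent.\<close>

definition indep_rv ::
  "'a measure \<Rightarrow> 'b measure \<Rightarrow> ('a \<Rightarrow> 'b) \<Rightarrow> 'c measure \<Rightarrow> ('a \<Rightarrow> 'c) \<Rightarrow> bool" where
  "indep_rv M N X N' Y \<longleftrightarrow>
     X \<in> measurable M N \<and> Y \<in> measurable M N' \<and>
     prob_space.indep_set M
       {X -` A \<inter> space M | A. A \<in> sets N} {Y -` B \<inter> space M | B. B \<in> sets N'}"

definition outer_prod :: "real ^ 'n \<Rightarrow> real ^ 'm \<Rightarrow> real ^ 'm ^ 'n" where
  "outer_prod x y = (\<chi> i j. x $ i * y $ j)"

end

theory Submission
  imports Defs "HOL-Real_Asymp.Real_Asymp"
begin

text \<open>Since \<open>\<theta>\<close> and the noise are Gaussian, the recursion computes the posterior law: given the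
  outputs up to time \<open>t\<close>, \<open>\<theta>\<close> is distributed as \<open>N(\<theta>hat\<^sub>t, P\<^sub>t)\<close>. Hence the quadratic form
  \<open>(\<theta> - \<theta>hat\<^sub>t)\<^sup>\<tau> P\<^sub>t\<^sup>-\<^sup>1 (\<theta> - \<theta>hat\<^sub>t)\<close> has the same \<open>\<chi>\<^sup>2\<close> law for every \<open>t\<close> and is almost surely
  \<open>O(log t)\<close> by Borel--Cantelli, and it remains to bound the smallest eigenvalue of
  \<open>P\<^sub>t\<^sup>-\<^sup>1 = I + \<sigma>\<^sup>-\<^sup>2 \<Sum>\<^sub>i\<^sub><\<^sub>t \<phi>\<^sub>i \<phi>\<^sub>i\<^sup>\<tau>\<close> below by a multiple of \<open>t\<close>.

  In the closed loop the next output is, given the past, \<open>N(0, s\<^sup>2)\<close> with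
  \<open>s\<^sup>2 = \<sigma>\<^sup>2 + \<phi>\<^sub>t\<^sup>\<tau> P\<^sub>t \<phi>\<^sub>t\<close>. By (ii) it lies in \<open>S\<^sub>L\<close> with a probability bounded below, whatever \<open>s\<close> is;
  once it does, the next variance is at most \<open>\<sigma>\<^sup>2 + L\<^sup>2\<close>, so that any given bounded open set is hit
  two steps later with a probability bounded below, and therefore with positive frequency. By A3 and
  compactness of the unit sphere, finitely many such sets excite all directions.\<close>

section \<open>Bilinear matrix operations and their Borel measurability\<close>

lemma bounded_bilinear_matrix_vector_mult_real:
  "bounded_bilinear (\<lambda>(A :: real ^ 'n::finite ^ 'm::finite) x. A *v x)"
  unfolding bilinear_conv_bounded_bilinear[symmetric]
  by (auto simp: bilinear_def matrix_vector_mult_add_rdistrib matrix_vector_right_distrib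
      scaleR_matrix_vector_assoc matrix_vector_mult_scaleR intro!: linearI)

lemma bounded_bilinear_matrix_matrix_mult_real:
  "bounded_bilinear (\<lambda>(A :: real ^ 'n::finite ^ 'm::finite) (B :: real ^ 'k::finite ^ 'n). A ** B)"
  unfolding bilinear_conv_bounded_bilinear[symmetric]
  by (auto simp: bilinear_def matrix_matrix_mult_def vec_eq_iff sum.distrib sum_distrib_left
      distrib_left distrib_right mult.assoc mult.left_commute intro!: linearI)

lemma bounded_bilinear_outer_prod:
  "bounded_bilinear (\<lambda>(x :: real ^ 'n::finite) (y :: real ^ 'm::finite). outer_prod x y)"
  unfolding bilinear_conv_bounded_bilinear[symmetric]
  by (auto simp: bilinear_def outer_prod_def vec_eq_iff algebra_simps intro!: linearI)

lemma borel_measurable_bounded_bilinear: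
  fixes h :: "'b::{second_countable_topology, real_normed_vector} \<Rightarrow>
    'c::{second_countable_topology, real_normed_vector} \<Rightarrow> 'd::real_normed_vector"
  assumes "bounded_bilinear h" "f \<in> borel_measurable M" "g \<in> borel_measurable M"
  shows "(\<lambda>x. h (f x) (g x)) \<in> borel_measurable M"
proof -
  have "continuous_on UNIV (\<lambda>x. h (fst x) (snd x))"
    by (intro bounded_bilinear.continuous_on[OF assms(1)] continuous_intros)
  from borel_measurable_continuous_Pair[OF assms(2,3) this] show ?thesis
    by simp
qed

lemmas borel_measurable_matrix_vector_mult [measurable (raw)] =
  borel_measurable_bounded_bilinear[OF bounded_bilinear_matrix_vector_mult_real]
lemmas borel_measurable_matrix_matrix_mult [measurable (raw)] =
  borel_measurable_bounded_bilinear[OF bounded_bilinear_matrix_matrix_mult_real]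
lemmas borel_measurable_outer_prod [measurable (raw)] =
  borel_measurable_bounded_bilinear[OF bounded_bilinear_outer_prod]

lemma outer_prod_mult_vec: "outer_prod x y *v v = (y \<bullet> v) *\<^sub>R x"
  by (simp add: outer_prod_def matrix_vector_mult_def vec_eq_iff inner_vec_def sum_distrib_left
      mult_ac)

section \<open>The least-squares recursion\<close>

text \<open>A state consists of the estimate, the matrix \<open>P\<close>, its inverse, the last output, and the
  number of visits of the earlier outputs (the last one excluded) to a fixed set \<open>B\<close>.\<close>

type_synonym 'n lstate = "(real ^ 'n) \<times> (real ^ 'n ^ 'n) \<times> (real ^ 'n ^ 'n) \<times> real \<times> real"

definition est :: "'n lstate \<Rightarrow> real ^ 'n" where "est S = fst S"
definition cov :: "'n lstate \<Rightarrow> real ^ 'n ^ 'n" where "cov S = fst (snd S)"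
definition prec :: "'n lstate \<Rightarrow> real ^ 'n ^ 'n" where "prec S = fst (snd (snd S))"
definition obs :: "'n lstate \<Rightarrow> real" where "obs S = fst (snd (snd (snd S)))"
definition cnt :: "'n lstate \<Rightarrow> real" where "cnt S = snd (snd (snd (snd S)))"

lemma lstate_sel [simp]:
  "est (m, P, Q, y, c) = m" "cov (m, P, Q, y, c) = P" "prec (m, P, Q, y, c) = Q"
  "obs (m, P, Q, y, c) = y" "cnt (m, P, Q, y, c) = c"
  by (simp_all add: est_def cov_def prec_def obs_def cnt_def)

lemma lstate_sel_measurable [measurable]:
  "est \<in> borel \<rightarrow>\<^sub>M (borel :: (real ^ 'n::finite) measure)"
  "cov \<in> borel \<rightarrow>\<^sub>M (borel :: (real ^ 'n ^ 'n) measure)"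
  "prec \<in> borel \<rightarrow>\<^sub>M (borel :: (real ^ 'n ^ 'n) measure)"
  "(obs :: 'n lstate \<Rightarrow> real) \<in> borel \<rightarrow>\<^sub>M borel"
  "(cnt :: 'n lstate \<Rightarrow> real) \<in> borel \<rightarrow>\<^sub>M borel"
  unfolding est_def[abs_def] cov_def[abs_def] prec_def[abs_def] obs_def[abs_def] cnt_def[abs_def]
  by (intro borel_measurable_continuous_onI continuous_intros)+

text \<open>For valid states this is the density of \<open>N(est S, cov S)\<close> without its
  normalising constant. The constant is supplied by \<open>mass S\<close>, an integral instead of a
  determinant.\<close>

definition dens :: "'n::finite lstate \<Rightarrow> real ^ 'n \<Rightarrow> real" where
  "dens S \<theta> = exp (- ((\<theta> - est S) \<bullet> (prec S *v (\<theta> - est S))) / 2)"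

definition mass :: "'n::finite lstate \<Rightarrow> ennreal" where
  "mass S = (\<integral>\<^sup>+\<theta>. ennreal (dens S \<theta>) \<partial>lborel)"

text \<open>The invariant of the recursion: covariance and precision are symmetric and mutually
  inverse, with \<open>0 \<le> cov S \<le> I \<le> prec S\<close> as quadratic forms. The upper
  bound on \<open>cov S\<close> controls the predictive variance; the lower bound on
  \<open>prec S\<close> makes the posterior density integrable.\<close>

definition valid :: "'n::finite lstate \<Rightarrow> bool" where
  "valid S \<longleftrightarrow>
     (\<forall>x. cov S *v (prec S *v x) = x) \<and> (\<forall>x. prec S *v (cov S *v x) = x) \<and>
     (\<forall>x y. x \<bullet> (cov S *v y) = (cov S *v x) \<bullet> y) \<and>
     (\<forall>x y. x \<bullet> (prec S *v y) = (prec S *v x) \<bullet> y) \<and>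
     (\<forall>x. 0 \<le> x \<bullet> (cov S *v x)) \<and> (\<forall>x. x \<bullet> (cov S *v x) \<le> x \<bullet> x) \<and>
     (\<forall>x. x \<bullet> x \<le> x \<bullet> (prec S *v x))"

lemma validD:
  assumes "valid S"
  shows "cov S *v (prec S *v x) = x" "prec S *v (cov S *v x) = x"
    "x \<bullet> (cov S *v z) = (cov S *v x) \<bullet> z" "x \<bullet> (prec S *v z) = (prec S *v x) \<bullet> z"
    "0 \<le> x \<bullet> (cov S *v x)" "x \<bullet> (cov S *v x) \<le> x \<bullet> x" "x \<bullet> x \<le> x \<bullet> (prec S *v x)"
  using assms unfolding valid_def by blast+

lemma dens_measurable [measurable (raw)]:
  assumes [measurable]: "f \<in> borel_measurable M" "g \<in> borel_measurable M"
  shows "(\<lambda>x. dens (f x) (g x)) \<in> borel_measurable M"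
  unfolding dens_def by measurable

lemma mass_measurable [measurable]: "mass \<in> borel_measurable borel"
  unfolding mass_def[abs_def] by measurable

locale ls_loop =
  fixes \<phi> :: "real \<Rightarrow> real ^ 'n::finite" and \<sigma> :: real and B :: "real set"
  assumes phi_measurable [measurable]: "\<phi> \<in> borel_measurable borel"
    and sigma_pos: "\<sigma> > 0"
    and B_measurable [measurable]: "B \<in> sets borel"
begin

text \<open>The predictive variance of the next output: the noise variance plus the posterior
  variance of \<open>\<theta> \<bullet> \<phi> (obs S)\<close>.\<close>

definition innov_var :: "'n lstate \<Rightarrow> real" where
  "innov_var S = \<sigma>\<^sup>2 + \<phi> (obs S) \<bullet> (cov S *v \<phi> (obs S))"

definition cov_upd :: "'n lstate \<Rightarrow> real ^ 'n ^ 'n" where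
  "cov_upd S = cov S - (1 / innov_var S) *\<^sub>R
     (cov S ** outer_prod (\<phi> (obs S)) (\<phi> (obs S)) ** cov S)"

text \<open>The argument \<open>y\<close> is the next output. Under the control
  \<open>u = - (est \<bullet> \<phi>)\<close> the innovation
  \<open>y - u - \<phi> \<bullet> est\<close> is \<open>y\<close> itself, so no separate control
  term enters. The count is updated with the old output, not with \<open>y\<close>.\<close>

definition step :: "'n lstate \<Rightarrow> real \<Rightarrow> 'n lstate" where
  "step S y =
     (est S + (1 / \<sigma>\<^sup>2 * y) *\<^sub>R (cov_upd S *v \<phi> (obs S)), cov_upd S,
      prec S + (1 / \<sigma>\<^sup>2) *\<^sub>R outer_prod (\<phi> (obs S)) (\<phi> (obs S)), y,
      cnt S + indicator B (obs S))"

lemma innov_var_measurable [measurable]: "innov_var \<in> borel_measurable borel"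
  unfolding innov_var_def[abs_def] by measurable

lemma cov_upd_measurable [measurable]: "cov_upd \<in> borel_measurable borel"
  unfolding cov_upd_def[abs_def] by measurable

lemma step_measurable [measurable (raw)]:
  assumes [measurable]: "f \<in> borel_measurable M" "g \<in> borel_measurable M"
  shows "(\<lambda>x. step (f x) (g x)) \<in> borel_measurable M"
  unfolding step_def by measurable

lemma innov_var_ge: "valid S \<Longrightarrow> \<sigma>\<^sup>2 \<le> innov_var S"
  using validD(5)[of S "\<phi> (obs S)"] by (simp add: innov_var_def)

lemma innov_var_pos: "valid S \<Longrightarrow> 0 < innov_var S"
  using innov_var_ge[of S] sigma_pos by (meson less_le_trans zero_less_power)

lemma innov_var_le:
  assumes "valid S" "norm (\<phi> (obs S)) \<le> L"
  shows "innov_var S \<le> \<sigma>\<^sup>2 + L\<^sup>2"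
proof -
  have "\<phi> (obs S) \<bullet> (cov S *v \<phi> (obs S)) \<le> \<phi> (obs S) \<bullet> \<phi> (obs S)"
    by (rule validD(6)[OF assms(1)])
  also have "\<dots> = (norm (\<phi> (obs S)))\<^sup>2" by (simp add: power2_norm_eq_inner)
  also have "\<dots> \<le> L\<^sup>2" using assms(2) by (intro power_mono) auto
  finally show ?thesis by (simp add: innov_var_def)
qed

lemma cov_upd_mult:
  assumes "valid S"
  shows "cov_upd S *v x = cov S *v x -
    ((\<phi> (obs S) \<bullet> (cov S *v x)) / innov_var S) *\<^sub>R (cov S *v \<phi> (obs S))"
  unfolding cov_upd_def
  by (simp add: matrix_vector_mult_diff_rdistrib scaleR_matrix_vector_assoc[symmetric]
      matrix_vector_mul_assoc[symmetric] outer_prod_mult_vec matrix_vector_mult_scaleR)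

text \<open>Brings the least-squares gain into Kalman form: \<open>1 / \<sigma>\<^sup>2\<close>
  times this vector is \<open>cov S *v \<phi> (obs S)\<close> divided by the predictive
  variance.\<close>

lemma cov_upd_phi:
  assumes "valid S"
  shows "cov_upd S *v \<phi> (obs S) = (\<sigma>\<^sup>2 / innov_var S) *\<^sub>R (cov S *v \<phi> (obs S))"
proof -
  have "cov_upd S *v \<phi> (obs S) =
      (1 - (\<phi> (obs S) \<bullet> (cov S *v \<phi> (obs S))) / innov_var S) *\<^sub>R (cov S *v \<phi> (obs S))"
    unfolding cov_upd_mult[OF assms] by (simp add: algebra_simps)
  also have "1 - (\<phi> (obs S) \<bullet> (cov S *v \<phi> (obs S))) / innov_var S = \<sigma>\<^sup>2 / innov_var S"
    using innov_var_pos[OF assms] by (simp add: field_simps) (simp add: innov_var_def)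
  finally show ?thesis .
qed

lemma step_prec_mult:
  "prec (step S y) *v x = prec S *v x + ((\<phi> (obs S) \<bullet> x) / \<sigma>\<^sup>2) *\<^sub>R \<phi> (obs S)"
  by (simp add: step_def matrix_vector_mult_add_rdistrib scaleR_matrix_vector_assoc[symmetric]
      outer_prod_mult_vec)

text \<open>The inverse relation is the Sherman-Morrison formula for a rank-one change. The bounds
  are inherited because the precision only grows and the covariance only shrinks.\<close>

lemma valid_step:
  assumes "valid S" shows "valid (step S y)"
proof -
  let ?v = "\<phi> (obs S)" let ?P = "cov S" let ?Q = "prec S" let ?s = "innov_var S"
  note PQ = validD(1)[OF assms] and Ps = validD(3)[OF assms] and Qs = validD(4)[OF assms]
    and P1 = validD(6)[OF assms] and Q1 = validD(7)[OF assms]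
  note s = innov_var_pos[OF assms] and sig = sigma_pos
  have cs: "cov (step S y) = cov_upd S" by (simp add: step_def)
  have inv: "cov (step S y) *v (prec (step S y) *v x) = x" for x
  proof -
    have "cov (step S y) *v (prec (step S y) *v x) =
        cov_upd S *v (?Q *v x) + ((?v \<bullet> x) / \<sigma>\<^sup>2) *\<^sub>R (cov_upd S *v ?v)"
      by (simp add: cs step_prec_mult matrix_vector_right_distrib matrix_vector_mult_scaleR)
    also have "\<dots> = x + (((?v \<bullet> x) / \<sigma>\<^sup>2) * (\<sigma>\<^sup>2 / ?s) - (?v \<bullet> x) / ?s) *\<^sub>R (?P *v ?v)"
      unfolding cov_upd_phi[OF assms] unfolding cov_upd_mult[OF assms] PQ
      by (simp add: scaleR_left_diff_distrib)
    also have "\<dots> = x" using sig by simp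
    finally show ?thesis .
  qed
  then have "cov (step S y) ** prec (step S y) = mat 1"
    by (simp add: matrix_eq matrix_vector_mul_assoc[symmetric])
  \<comment> \<open>For square matrices a one-sided inverse is two-sided, so only one product had to
    be computed.\<close>
  then have "prec (step S y) ** cov (step S y) = mat 1"
    by (simp add: matrix_left_right_inverse)
  then have inv': "prec (step S y) *v (cov (step S y) *v x) = x" for x
    by (simp add: matrix_vector_mul_assoc)
  have Psym: "x \<bullet> (cov (step S y) *v z) = (cov (step S y) *v x) \<bullet> z" for x z
  proof -
    have "x \<bullet> (?P *v ?v) = ?v \<bullet> (?P *v x)" by (metis Ps inner_commute)
    then show ?thesis
      unfolding cs cov_upd_mult[OF assms] using Ps[of x z] Ps[of ?v z]
      by (simp add: inner_diff_right inner_diff_left)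
  qed
  have Qsym: "x \<bullet> (prec (step S y) *v z) = (prec (step S y) *v x) \<bullet> z" for x z
    unfolding step_prec_mult using Qs[of x z]
    by (simp add: inner_add_right inner_add_left inner_commute[of ?v])
  have Qge: "x \<bullet> (?Q *v x) \<le> x \<bullet> (prec (step S y) *v x)" for x
    unfolding step_prec_mult by (simp add: inner_add_right inner_commute[of x ?v])
  have Ple: "x \<bullet> (cov (step S y) *v x) \<le> x \<bullet> (?P *v x)" for x
  proof -
    have "x \<bullet> (?P *v ?v) = ?v \<bullet> (?P *v x)" by (metis Ps inner_commute)
    then show ?thesis
      unfolding cs cov_upd_mult[OF assms] using s by (simp add: inner_diff_right)
  qed
  \<comment> \<open>The covariance is updated by a subtraction, so positivity is read off the
    precision instead: with \<open>z = P x\<close> one has \<open>x = Q z\<close>, and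
    \<open>x \<bullet> z\<close> becomes the form of \<open>Q\<close> at \<open>z\<close>.\<close>
  have Pge: "0 \<le> x \<bullet> (cov (step S y) *v x)" for x
  proof -
    let ?z = "cov (step S y) *v x"
    have "x \<bullet> ?z = (prec (step S y) *v ?z) \<bullet> ?z" by (simp add: inv')
    also have "\<dots> = ?z \<bullet> (prec (step S y) *v ?z)" by (simp add: inner_commute)
    also have "\<dots> \<ge> 0" using Qge[of ?z] Q1[of ?z] inner_ge_zero[of ?z] by linarith
    finally show ?thesis .
  qed
  show ?thesis
    unfolding valid_def
    using inv inv' Psym Qsym Pge order_trans[OF Ple P1] order_trans[OF Q1 Qge]
    by (intro conjI allI)
qed

text \<open>Completion of the square: prior times likelihood equals evidence times posterior.\<close>

lemma dens_step:
  assumes "valid S"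
  shows "normal_density 0 \<sigma> (y - (\<theta> - est S) \<bullet> \<phi> (obs S)) * dens S \<theta> =
    normal_density 0 (sqrt (innov_var S)) y * dens (step S y) \<theta> * (sqrt (innov_var S) / \<sigma>)"
proof -
  let ?v = "\<phi> (obs S)" let ?P = "cov S" let ?Q = "prec S" let ?s = "innov_var S"
  define e a k b where "e = \<theta> - est S" and "a = ?v \<bullet> (?P *v ?v)" and "k = y / ?s" and "b = e \<bullet> ?v"
  note QP = validD(2)[OF assms] and Ps = validD(3)[OF assms] and Qs = validD(4)[OF assms]
  note s = innov_var_pos[OF assms] and sig = sigma_pos
  have sa: "?s = \<sigma>\<^sup>2 + a" by (simp add: innov_var_def a_def)
  have e': "\<theta> - est (step S y) = e - k *\<^sub>R (?P *v ?v)"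
    using sig by (simp add: step_def cov_upd_phi[OF assms] e_def k_def)
  have q1: "(e - k *\<^sub>R (?P *v ?v)) \<bullet> (?Q *v (e - k *\<^sub>R (?P *v ?v))) =
      e \<bullet> (?Q *v e) - 2 * k * b + k\<^sup>2 * a"
  proof -
    have "(?P *v ?v) \<bullet> (?Q *v e) = b"
      unfolding Qs QP b_def by (rule inner_commute)
    moreover have "(?P *v ?v) \<bullet> ?v = a"
      unfolding a_def by (rule inner_commute)
    ultimately show ?thesis
      by (simp add: matrix_vector_mult_diff_distrib matrix_vector_mult_scaleR QP inner_diff_left
          inner_diff_right b_def power2_eq_square algebra_simps)
  qed
  have q2: "?v \<bullet> (e - k *\<^sub>R (?P *v ?v)) = b - k * a"
    by (simp add: inner_diff_right a_def b_def inner_commute[of ?v e])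
  have "(\<theta> - est (step S y)) \<bullet> (prec (step S y) *v (\<theta> - est (step S y))) =
      e \<bullet> (?Q *v e) - 2 * k * b + k\<^sup>2 * a + (b - k * a)\<^sup>2 / \<sigma>\<^sup>2"
    unfolding e' step_prec_mult inner_add_right q1
    by (simp add: inner_commute[of "e - k *\<^sub>R (?P *v ?v)" ?v] q2 power2_eq_square)
  also have "\<dots> = e \<bullet> (?Q *v e) + (y - b)\<^sup>2 / \<sigma>\<^sup>2 - y\<^sup>2 / ?s"
  proof -
    have y: "y = k * (\<sigma>\<^sup>2 + a)" using s by (simp add: k_def sa)
    have "y\<^sup>2 / ?s = k\<^sup>2 * (\<sigma>\<^sup>2 + a)"
      using s by (simp add: y sa power2_eq_square field_simps)
    moreover have "(y - b)\<^sup>2 / \<sigma>\<^sup>2 = (b - k * a)\<^sup>2 / \<sigma>\<^sup>2 - 2 * k * (b - k * a) + k\<^sup>2 * \<sigma>\<^sup>2"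
      using sig by (simp add: y field_simps power2_eq_square)
    ultimately show ?thesis by (simp add: algebra_simps power2_eq_square)
  qed
  \<comment> \<open>Two splittings of one exponent, that of the joint law of parameter and output:
    prior plus likelihood on the left, updated posterior plus predictive law on the right.\<close>
  finally have q: "e \<bullet> (?Q *v e) + (y - b)\<^sup>2 / \<sigma>\<^sup>2 =
      (\<theta> - est (step S y)) \<bullet> (prec (step S y) *v (\<theta> - est (step S y))) + y\<^sup>2 / ?s"
    by simp
  have ex: "exp (- (y - b)\<^sup>2 / (2 * \<sigma>\<^sup>2)) * dens S \<theta> =
      exp (- y\<^sup>2 / (2 * ?s)) * dens (step S y) \<theta>"
  proof -
    have "- (y - b)\<^sup>2 / (2 * \<sigma>\<^sup>2) + - (e \<bullet> (?Q *v e)) / 2 = - (e \<bullet> (?Q *v e) + (y - b)\<^sup>2 / \<sigma>\<^sup>2) / 2"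
      by (simp add: field_simps)
    also have "\<dots> = - y\<^sup>2 / (2 * ?s) +
        - ((\<theta> - est (step S y)) \<bullet> (prec (step S y) *v (\<theta> - est (step S y)))) / 2"
      unfolding q by (simp add: field_simps)
    finally show ?thesis
      by (simp add: dens_def e_def[symmetric] exp_add[symmetric])
  qed
  \<comment> \<open>The factor \<open>sqrt s / \<sigma>\<close> arises because both functions
    \<open>dens\<close> are unnormalised; \<open>mass_step\<close> identifies it as the ratio of
    their masses.\<close>
  have nf: "1 / sqrt (2 * pi * \<sigma>\<^sup>2) = 1 / sqrt (2 * pi * ?s) * (sqrt ?s / \<sigma>)"
    using s sig by (simp add: real_sqrt_mult)
  have "normal_density 0 \<sigma> (y - b) * dens S \<theta> =
      1 / sqrt (2 * pi * \<sigma>\<^sup>2) * (exp (- (y - b)\<^sup>2 / (2 * \<sigma>\<^sup>2)) * dens S \<theta>)"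
    by (simp add: normal_density_def)
  also have "\<dots> = normal_density 0 (sqrt ?s) y * dens (step S y) \<theta> * (sqrt ?s / \<sigma>)"
    unfolding ex nf using s by (simp add: normal_density_def)
  finally show ?thesis by (simp add: b_def e_def)
qed

end

section \<open>Gaussian integrals and changes of variables\<close>

lemma nn_integral_normal_density:
  assumes "0 < s"
  shows "(\<integral>\<^sup>+x. ennreal (normal_density \<mu> s x) \<partial>lborel) = 1"
proof -
  interpret prob_space "density lborel (normal_density \<mu> s)"
    using assms by (rule prob_space_normal_density)
  show ?thesis
    using emeasure_space_1 by (simp add: emeasure_density)
qed

lemma nn_integral_gaussian_finite:
  "(\<integral>\<^sup>+x. ennreal (exp (- (x \<bullet> x) / 2)) \<partial>(lborel :: 'a::euclidean_space measure)) < \<infinity>"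
proof -
  have "(\<integral>\<^sup>+x. ennreal (exp (- x\<^sup>2 / 2)) \<partial>(lborel :: real measure)) =
      (\<integral>\<^sup>+x. ennreal (sqrt (2 * pi)) * ennreal (normal_density 0 1 x) \<partial>lborel)"
    by (intro nn_integral_cong) (simp add: normal_density_def flip: ennreal_mult)
  also have "\<dots> = ennreal (sqrt (2 * pi))"
    by (subst nn_integral_cmult) (auto simp: nn_integral_normal_density)
  finally have 1: "(\<integral>\<^sup>+x. ennreal (exp (- x\<^sup>2 / 2)) \<partial>(lborel :: real measure)) < \<infinity>"
    by simp
  have "(\<integral>\<^sup>+x. ennreal (exp (- (x \<bullet> x) / 2)) \<partial>(lborel :: 'a measure)) =
      (\<integral>\<^sup>+x. (\<Prod>b\<in>Basis. ennreal (exp (- (x \<bullet> b)\<^sup>2 / 2))) \<partial>(lborel :: 'a measure))"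
  proof (rule nn_integral_cong)
    fix x :: 'a
    have "- (x \<bullet> x) / 2 = (\<Sum>b\<in>Basis. - (x \<bullet> b)\<^sup>2 / 2)"
      by (simp add: euclidean_inner[of x x] sum_divide_distrib sum_negf power2_eq_square)
    then show "ennreal (exp (- (x \<bullet> x) / 2)) = (\<Prod>b\<in>Basis. ennreal (exp (- (x \<bullet> b)\<^sup>2 / 2)))"
      by (simp add: exp_sum prod_ennreal)
  qed
  also have "\<dots> = (\<Prod>b\<in>(Basis :: 'a set). \<integral>\<^sup>+x. ennreal (exp (- x\<^sup>2 / 2)) \<partial>lborel)"
    by (rule nn_integral_lborel_prod) auto
  also have "\<dots> < \<infinity>"
    using 1 by (simp add: power_less_top_ennreal)
  finally show ?thesis .
qed

lemma nn_integral_lborel_translate: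
  fixes f :: "'a::euclidean_space \<Rightarrow> ennreal"
  assumes [measurable]: "f \<in> borel_measurable borel"
  shows "(\<integral>\<^sup>+x. f (x - c) \<partial>lborel) = (\<integral>\<^sup>+x. f x \<partial>lborel)"
proof -
  have "(\<integral>\<^sup>+x. f x \<partial>lborel) = (\<integral>\<^sup>+x. f x \<partial>distr lborel borel ((+) (- c)))"
    by (simp only: lborel_distr_plus)
  also have "\<dots> = (\<integral>\<^sup>+x. f (- c + x) \<partial>lborel)"
    by (rule nn_integral_distr) auto
  finally show ?thesis by simp
qed

lemma nn_integral_lborel_scale:
  fixes f :: "'a::euclidean_space \<Rightarrow> ennreal"
  assumes [measurable]: "f \<in> borel_measurable borel" and c: "c > 0"
  shows "(\<integral>\<^sup>+x. f x \<partial>lborel) = ennreal (c ^ DIM('a)) * (\<integral>\<^sup>+x. f (c *\<^sub>R x) \<partial>lborel)"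
proof -
  have "(\<integral>\<^sup>+x. f x \<partial>lborel) =
      (\<integral>\<^sup>+x. f x \<partial>density (distr lborel borel (\<lambda>x. 0 + c *\<^sub>R x)) (\<lambda>_. \<bar>c\<bar> ^ DIM('a)))"
    using lborel_affine[of c "0 :: 'a"] c by simp
  also have "\<dots> = ennreal (c ^ DIM('a)) * (\<integral>\<^sup>+x. f (c *\<^sub>R x) \<partial>lborel)"
    using c by (simp add: nn_integral_density nn_integral_distr nn_integral_cmult)
  finally show ?thesis .
qed

section \<open>Posterior law and prediction kernel\<close>

text \<open>Translation invariance removes the estimate. The mass thus depends on the precision
  alone, whose update does not involve the new output.\<close>

lemma mass_eq_prec:
  "mass S = (\<integral>\<^sup>+x. ennreal (exp (- (x \<bullet> (prec S *v x)) / 2)) \<partial>lborel)"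
  unfolding mass_def dens_def
  by (rule nn_integral_lborel_translate[where f = "\<lambda>x. ennreal (exp (- (x \<bullet> (prec S *v x)) / 2))"])
    measurable

lemma mass_finite:
  fixes S :: "'n::finite lstate"
  assumes "valid S" shows "mass S < \<infinity>"
proof -
  have "mass S \<le> (\<integral>\<^sup>+x. ennreal (exp (- (x \<bullet> x) / 2)) \<partial>(lborel :: (real ^ 'n) measure))"
    unfolding mass_eq_prec
    by (intro nn_integral_mono ennreal_leI) (simp add: validD(7)[OF assms])
  then show ?thesis using nn_integral_gaussian_finite by (rule le_less_trans)
qed

lemma mass_pos: "mass (S :: 'n::finite lstate) \<noteq> 0"
proof
  assume "mass S = 0"
  then have "AE \<theta> in lborel. ennreal (dens S \<theta>) = 0"
    unfolding mass_def by (subst (asm) nn_integral_0_iff_AE) auto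
  then have "AE \<theta> in (lborel :: (real ^ 'n) measure). False"
    by (simp add: dens_def)
  then show False
    by (simp add: AE_iff_measurable[OF _ refl] emeasure_lborel_UNIV)
qed

text \<open>The expectation of \<open>g \<theta> S\<close> with \<open>S\<close> held fixed and
  \<open>\<theta>\<close> drawn from the posterior encoded in \<open>S\<close>.\<close>

definition post :: "(real ^ 'n::finite \<Rightarrow> 'n lstate \<Rightarrow> ennreal) \<Rightarrow> 'n lstate \<Rightarrow> ennreal" where
  "post g S = (\<integral>\<^sup>+\<theta>. g \<theta> S * ennreal (dens S \<theta>) \<partial>lborel) / mass S"

lemma post_measurable [measurable]:
  assumes [measurable]: "case_prod g \<in> borel_measurable (borel \<Otimes>\<^sub>M borel)"
  shows "post g \<in> borel_measurable borel"
  unfolding post_def[abs_def] by measurable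

lemma post_const:
  assumes "valid S" shows "post (\<lambda>_. f) S = f S"
proof -
  have "(\<integral>\<^sup>+\<theta>. f S * ennreal (dens S \<theta>) \<partial>lborel) = f S * mass S"
    unfolding mass_def by (rule nn_integral_cmult) auto
  then show ?thesis
    unfolding post_def using mass_pos[of S] mass_finite[OF assms]
    by (simp add: ennreal_mult_divide_eq)
qed

context ls_loop
begin

text \<open>The transition operator of the state once the parameter is averaged out: the next output
  follows the predictive law, which is centred because the control cancels the predicted
  value.\<close>

definition kern :: "('n lstate \<Rightarrow> ennreal) \<Rightarrow> 'n lstate \<Rightarrow> ennreal" where
  "kern f S = (\<integral>\<^sup>+y. f (step S y) * ennreal (normal_density 0 (sqrt (innov_var S)) y) \<partial>lborel)"

lemma kern_measurable [measurable]:
  assumes [measurable]: "f \<in> borel_measurable borel"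
  shows "kern f \<in> borel_measurable borel"
  unfolding kern_def[abs_def] normal_density_def by measurable

text \<open>Tonelli's theorem combined with \<open>dens_step\<close>: drawing first
  \<open>\<theta>\<close> and then \<open>y\<close> is exchanged for drawing first \<open>y\<close>
  and then \<open>\<theta>\<close> from the updated, still unnormalised, posterior.\<close>

lemma evidence_swap:
  assumes S: "valid S" and [measurable]: "case_prod g \<in> borel_measurable (borel \<Otimes>\<^sub>M borel)"
  shows "(\<integral>\<^sup>+\<theta>. (\<integral>\<^sup>+y. g \<theta> (step S y) *
        ennreal (normal_density 0 \<sigma> (y - (\<theta> - est S) \<bullet> \<phi> (obs S))) \<partial>lborel) *
        ennreal (dens S \<theta>) \<partial>lborel) =
    (\<integral>\<^sup>+y. (ennreal (sqrt (innov_var S) / \<sigma>) *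
        (\<integral>\<^sup>+\<theta>. g \<theta> (step S y) * ennreal (dens (step S y) \<theta>) \<partial>lborel)) *
        ennreal (normal_density 0 (sqrt (innov_var S)) y) \<partial>lborel)"
proof -
  let ?n = "\<lambda>y. ennreal (normal_density 0 (sqrt (innov_var S)) y)"
  let ?r = "ennreal (sqrt (innov_var S) / \<sigma>)"
  note [simp] = innov_var_pos[OF S, THEN less_imp_le] sigma_pos[THEN less_imp_le]
  have d0: "0 \<le> dens T \<theta>" for T :: "'n lstate" and \<theta> by (simp add: dens_def)
  have id: "ennreal (normal_density 0 \<sigma> (y - (\<theta> - est S) \<bullet> \<phi> (obs S))) * ennreal (dens S \<theta>) =
      ?n y * ennreal (dens (step S y) \<theta>) * ?r" for y \<theta>
    by (simp add: dens_step[OF S] d0 flip: ennreal_mult)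
  have "(\<integral>\<^sup>+\<theta>. (\<integral>\<^sup>+y. g \<theta> (step S y) *
        ennreal (normal_density 0 \<sigma> (y - (\<theta> - est S) \<bullet> \<phi> (obs S))) \<partial>lborel) *
        ennreal (dens S \<theta>) \<partial>lborel) =
      (\<integral>\<^sup>+\<theta>. (\<integral>\<^sup>+y. (?r * ?n y) * (g \<theta> (step S y) * ennreal (dens (step S y) \<theta>)) \<partial>lborel) \<partial>lborel)"
  proof (rule nn_integral_cong)
    fix \<theta>
    have "(\<integral>\<^sup>+y. g \<theta> (step S y) *
          ennreal (normal_density 0 \<sigma> (y - (\<theta> - est S) \<bullet> \<phi> (obs S))) \<partial>lborel) * ennreal (dens S \<theta>) =
        (\<integral>\<^sup>+y. g \<theta> (step S y) *
          ennreal (normal_density 0 \<sigma> (y - (\<theta> - est S) \<bullet> \<phi> (obs S))) * ennreal (dens S \<theta>) \<partial>lborel)"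
      by (rule nn_integral_multc[symmetric]) (unfold normal_density_def, measurable)
    also have "\<dots> = (\<integral>\<^sup>+y. (?r * ?n y) * (g \<theta> (step S y) * ennreal (dens (step S y) \<theta>)) \<partial>lborel)"
      unfolding mult.assoc id by (intro nn_integral_cong) (simp only: mult_ac)
    finally show "(\<integral>\<^sup>+y. g \<theta> (step S y) *
          ennreal (normal_density 0 \<sigma> (y - (\<theta> - est S) \<bullet> \<phi> (obs S))) \<partial>lborel) * ennreal (dens S \<theta>) =
        (\<integral>\<^sup>+y. (?r * ?n y) * (g \<theta> (step S y) * ennreal (dens (step S y) \<theta>)) \<partial>lborel)" .
  qed
  also have "\<dots> = (\<integral>\<^sup>+y. (\<integral>\<^sup>+\<theta>. (?r * ?n y) * (g \<theta> (step S y) * ennreal (dens (step S y) \<theta>)) \<partial>lborel) \<partial>lborel)"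
    by (rule lborel_pair.Fubini') measurable
  also have "\<dots> = (\<integral>\<^sup>+y. (?r * ?n y) * (\<integral>\<^sup>+\<theta>. g \<theta> (step S y) * ennreal (dens (step S y) \<theta>) \<partial>lborel) \<partial>lborel)"
    by (intro nn_integral_cong nn_integral_cmult) measurable
  finally show ?thesis by (simp only: mult_ac)
qed

text \<open>Testing \<open>evidence_swap\<close> with the constant 1 gives the ratio of the masses
  without determinants, since the updated mass is the same for every output.\<close>

lemma mass_step:
  assumes S: "valid S"
  shows "ennreal (sqrt (innov_var S) / \<sigma>) * mass (step S y) = mass S"
proof -
  have const: "mass (step S z) = mass (step S y)" for z
    by (simp add: mass_eq_prec step_def)
  have shift: "normal_density 0 \<sigma> (z - c) = normal_density c \<sigma> z" for z c
    by (simp add: normal_density_def)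
  have "mass S = (\<integral>\<^sup>+\<theta>. (\<integral>\<^sup>+y. 1 *
        ennreal (normal_density 0 \<sigma> (y - (\<theta> - est S) \<bullet> \<phi> (obs S))) \<partial>lborel) *
        ennreal (dens S \<theta>) \<partial>lborel)"
    unfolding shift mult_1_left nn_integral_normal_density[OF sigma_pos] by (simp only: mass_def mult_1_left)
  also have "\<dots> = (\<integral>\<^sup>+z. (ennreal (sqrt (innov_var S) / \<sigma>) * mass (step S z)) *
        ennreal (normal_density 0 (sqrt (innov_var S)) z) \<partial>lborel)"
    using evidence_swap[OF S, of "\<lambda>_ _. 1"] by (simp add: mass_def)
  also have "\<dots> = (\<integral>\<^sup>+z. (ennreal (sqrt (innov_var S) / \<sigma>) * mass (step S y)) *
        ennreal (normal_density 0 (sqrt (innov_var S)) z) \<partial>lborel)"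
    by (intro nn_integral_cong) (subst const, rule refl)
  also have "\<dots> = ennreal (sqrt (innov_var S) / \<sigma>) * mass (step S y)"
    using innov_var_pos[OF S]
    by (subst nn_integral_cmult) (auto simp: nn_integral_normal_density)
  finally show ?thesis ..
qed

text \<open>Bayes' rule in integrated form: one step of the true dynamics averaged over the current
  posterior equals a prediction step followed by averaging over the updated posterior.\<close>

lemma post_step:
  assumes S: "valid S" and [measurable]: "case_prod g \<in> borel_measurable (borel \<Otimes>\<^sub>M borel)"
  shows "post (\<lambda>\<theta> S. \<integral>\<^sup>+y. g \<theta> (step S y) *
      ennreal (normal_density 0 \<sigma> (y - (\<theta> - est S) \<bullet> \<phi> (obs S))) \<partial>lborel) S = kern (post g) S"
proof -
  let ?I = "\<lambda>T. \<integral>\<^sup>+\<theta>. g \<theta> T * ennreal (dens T \<theta>) \<partial>lborel"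
  let ?n = "\<lambda>y. ennreal (normal_density 0 (sqrt (innov_var S)) y)"
  have "ennreal (sqrt (innov_var S) / \<sigma>) * ?I (step S y) = mass S * post g (step S y)" for y
  proof -
    have "mass S * post g (step S y) = ennreal (sqrt (innov_var S) / \<sigma>) *
        (?I (step S y) / mass (step S y) * mass (step S y))"
      unfolding post_def mass_step[OF S, of y, symmetric] by (simp add: mult_ac)
    also have "?I (step S y) / mass (step S y) * mass (step S y) = ?I (step S y)"
      using mass_pos[of "step S y"] mass_finite[OF valid_step[OF S, of y]]
      by (simp add: ennreal_divide_times ennreal_mult_divide_eq)
    finally show ?thesis ..
  qed
  then have "(\<integral>\<^sup>+y. (ennreal (sqrt (innov_var S) / \<sigma>) * ?I (step S y)) * ?n y \<partial>lborel) =
      (\<integral>\<^sup>+y. mass S * (post g (step S y) * ?n y) \<partial>lborel)"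
    by (simp add: mult.assoc)
  also have "\<dots> = mass S * kern (post g) S"
    unfolding kern_def by (rule nn_integral_cmult) measurable
  finally show ?thesis
    unfolding post_def[of "\<lambda>\<theta> S. \<integral>\<^sup>+y. g \<theta> (step S y) *
      ennreal (normal_density 0 \<sigma> (y - (\<theta> - est S) \<bullet> \<phi> (obs S))) \<partial>lborel"] evidence_swap[OF S assms(2)]
    using mass_pos[of S] mass_finite[OF S]
    by (simp add: mult.commute[of "mass S"] ennreal_mult_divide_eq)
qed

end

section \<open>Product laws and integration over a fresh noise variable\<close>

lemma (in prob_space) distr_pair_indep_rv:
  assumes "indep_rv M N X N' Y"
  shows "distr M (N \<Otimes>\<^sub>M N') (\<lambda>\<omega>. (X \<omega>, Y \<omega>)) = distr M N X \<Otimes>\<^sub>M distr M N' Y"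
proof -
  have [measurable]: "X \<in> measurable M N" "Y \<in> measurable M N'"
    and ind: "indep_set {X -` A \<inter> space M | A. A \<in> sets N} {Y -` B \<inter> space M | B. B \<in> sets N'}"
    using assms by (auto simp: indep_rv_def)
  interpret X: prob_space "distr M N X" by (rule prob_space_distr) measurable
  interpret Y: prob_space "distr M N' Y" by (rule prob_space_distr) measurable
  have "distr M N X \<Otimes>\<^sub>M distr M N' Y = distr M (N \<Otimes>\<^sub>M N') (\<lambda>\<omega>. (X \<omega>, Y \<omega>))"
  proof (rule pair_measure_eqI)
    show "sigma_finite_measure (distr M N X)" "sigma_finite_measure (distr M N' Y)"
      by unfold_locales
    show "sets (distr M N X \<Otimes>\<^sub>M distr M N' Y) = sets (distr M (N \<Otimes>\<^sub>M N') (\<lambda>\<omega>. (X \<omega>, Y \<omega>)))"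
      by (simp cong: sets_pair_measure_cong)
    fix A B assume "A \<in> sets (distr M N X)" "B \<in> sets (distr M N' Y)"
    then have [measurable]: "A \<in> sets N" "B \<in> sets N'" by auto
    have "prob ((X -` A \<inter> space M) \<inter> (Y -` B \<inter> space M)) =
        prob (X -` A \<inter> space M) * prob (Y -` B \<inter> space M)"
      by (rule indep_setD[OF ind]) auto
    moreover have "(\<lambda>\<omega>. (X \<omega>, Y \<omega>)) -` (A \<times> B) \<inter> space M =
        (X -` A \<inter> space M) \<inter> (Y -` B \<inter> space M)" by auto
    ultimately show "emeasure (distr M N X) A * emeasure (distr M N' Y) B =
        emeasure (distr M (N \<Otimes>\<^sub>M N') (\<lambda>\<omega>. (X \<omega>, Y \<omega>))) (A \<times> B)"
      by (simp add: emeasure_distr emeasure_eq_measure ennreal_mult)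
  qed
  then show ?thesis ..
qed

text \<open>The joint law of \<open>\<theta>\<close> and the noise sequence is a product and
  \<open>F\<close> ignores coordinate \<open>i\<close>, so this coordinate can be integrated against
  its density with everything else fixed. This takes the place of conditioning on the past.\<close>

lemma (in prob_space) nn_integral_fresh_coordinate:
  fixes w :: "'i \<Rightarrow> 'a \<Rightarrow> real" and \<theta> :: "'a \<Rightarrow> 'b"
    and F :: "'b \<Rightarrow> ('i \<Rightarrow> real) \<Rightarrow> 'c" and p :: "real \<Rightarrow> ennreal"
  assumes indep: "indep_vars (\<lambda>_. borel) w I" and i: "i \<in> I"
    and dist: "distributed M lborel (w i) p"
    and ind: "indep_rv M N \<theta> (PiM I (\<lambda>_. borel)) (\<lambda>\<omega>. \<lambda>j\<in>I. w j \<omega>)"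
    and F [measurable]: "case_prod F \<in> measurable (N \<Otimes>\<^sub>M PiM I (\<lambda>_. borel)) K"
    and upd: "\<And>x W v. F x (W(i := v)) = F x W"
    and h [measurable]: "case_prod h \<in> borel_measurable (K \<Otimes>\<^sub>M borel)"
  shows "(\<integral>\<^sup>+\<omega>. h (F (\<theta> \<omega>) (\<lambda>j\<in>I. w j \<omega>)) (w i \<omega>) \<partial>M) =
    (\<integral>\<^sup>+\<omega>. (\<integral>\<^sup>+x. h (F (\<theta> \<omega>) (\<lambda>j\<in>I. w j \<omega>)) x * p x \<partial>lborel) \<partial>M)"
proof -
  let ?W = "\<lambda>\<omega>. \<lambda>j\<in>I. w j \<omega>"
  let ?PB = "PiM I (\<lambda>_. borel :: real measure)"
  have rv: "random_variable borel (w j)" if "j \<in> I" for j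
    using indep that by (auto simp: indep_vars_def)
  have [measurable]: "\<theta> \<in> measurable M N" "?W \<in> measurable M ?PB"
    using ind by (auto simp: indep_rv_def)
  define D where "D = (\<lambda>j. distr M borel (w j))"
  define L where "L = PiM (I - {i}) D"
  have D: "prob_space (D j)" if "j \<in> I" for j
    unfolding D_def using rv[OF that] by (rule prob_space_distr)
  have sD [measurable_cong]: "sets (D j) = sets borel" for j by (simp add: D_def)
  have Di: "D i = density lborel p"
    using dist unfolding D_def by (simp add: distributed_def cong: distr_cong)
  have [measurable]: "p \<in> borel_measurable borel"
    using dist by (simp add: distributed_def)
  have law: "distr M ?PB ?W = PiM I D"
    unfolding D_def using indep i rv by (subst (asm) indep_vars_iff_distr_eq_PiM') auto
  have ins: "insert i (I - {i}) = I" using i by auto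
  interpret Di: prob_space "D i" using i by (rule D)
  interpret L: prob_space L
    unfolding L_def using D by (intro prob_space_PiM) auto
  interpret DL: pair_sigma_finite "D i" L ..
  \<comment> \<open>The product law arises by drawing coordinate \<open>i\<close> and the other
    coordinates independently and inserting the former.\<close>
  have split: "distr (D i \<Otimes>\<^sub>M L) (PiM I D) (\<lambda>(x, X). X(i := x)) = PiM I D"
    unfolding L_def using distr_pair_PiM_eq_PiM[of "I - {i}" D i] D i unfolding ins by auto
  have sP [measurable_cong]: "sets (PiM I D) = sets ?PB"
    by (intro sets_PiM_cong) (auto simp: sD)
  have sL [measurable_cong]: "sets L = sets (PiM (I - {i}) (\<lambda>_. borel))"
    unfolding L_def by (intro sets_PiM_cong) (auto simp: sD)
  have upd_meas [measurable]: "(\<lambda>(x, X). X(i := x)) \<in> measurable (borel \<Otimes>\<^sub>M PiM (I - {i}) (\<lambda>_. borel)) ?PB"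
    unfolding case_prod_beta'
    by (rule measurable_fun_upd[where J = "I - {i}"]) (use i in auto)
  have [measurable]: "(\<lambda>v. X(i := v)) \<in> borel \<rightarrow>\<^sub>M ?PB" if "X \<in> space L" for X
    using measurable_compose[OF measurable_Pair2' upd_meas, of X] that
    by (simp add: sets_eq_imp_space_eq[OF sL])
  interpret PD: prob_space "PiM I D" using D by (intro prob_space_PiM) auto
  interpret T: prob_space "distr M N \<theta>" by (rule prob_space_distr) measurable
  have joint: "(\<integral>\<^sup>+\<omega>. G (\<theta> \<omega>) (?W \<omega>) \<partial>M) =
      (\<integral>\<^sup>+x. (\<integral>\<^sup>+X. (\<integral>\<^sup>+v. G x (X(i := v)) * p v \<partial>lborel) \<partial>L) \<partial>distr M N \<theta>)"
    if [measurable]: "case_prod G \<in> borel_measurable (N \<Otimes>\<^sub>M ?PB)" for G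
  proof -
    have "(\<integral>\<^sup>+\<omega>. G (\<theta> \<omega>) (?W \<omega>) \<partial>M) =
        (\<integral>\<^sup>+z. case_prod G z \<partial>distr M (N \<Otimes>\<^sub>M ?PB) (\<lambda>\<omega>. (\<theta> \<omega>, ?W \<omega>)))"
      by (subst nn_integral_distr) auto
    also have "\<dots> = (\<integral>\<^sup>+z. case_prod G z \<partial>(distr M N \<theta> \<Otimes>\<^sub>M PiM I D))"
      by (simp only: distr_pair_indep_rv[OF ind] law)
    also have "\<dots> = (\<integral>\<^sup>+x. (\<integral>\<^sup>+X. G x X \<partial>PiM I D) \<partial>distr M N \<theta>)"
      by (subst PD.nn_integral_fst[symmetric]) auto
    also have "\<dots> = (\<integral>\<^sup>+x. (\<integral>\<^sup>+X. (\<integral>\<^sup>+v. G x (X(i := v)) * p v \<partial>lborel) \<partial>L) \<partial>distr M N \<theta>)"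
    proof (rule nn_integral_cong)
      fix x assume "x \<in> space (distr M N \<theta>)"
      then have [simp]: "x \<in> space N" by simp
      have [measurable]: "G x \<in> borel_measurable ?PB"
        using measurable_compose[OF measurable_Pair1' that, of x] by simp
      have "(\<integral>\<^sup>+X. G x X \<partial>PiM I D) =
          (\<integral>\<^sup>+X. G x X \<partial>distr (D i \<Otimes>\<^sub>M L) (PiM I D) (\<lambda>(x, X). X(i := x)))"
        by (simp only: split)
      also have "\<dots> = (\<integral>\<^sup>+z. G x ((snd z)(i := fst z)) \<partial>(D i \<Otimes>\<^sub>M L))"
        by (subst nn_integral_distr) (auto simp: case_prod_beta')
      also have "\<dots> = (\<integral>\<^sup>+X. (\<integral>\<^sup>+v. G x (X(i := v)) \<partial>D i) \<partial>L)"
        by (subst DL.nn_integral_snd[symmetric]) (auto simp: case_prod_beta')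
      also have "\<dots> = (\<integral>\<^sup>+X. (\<integral>\<^sup>+v. G x (X(i := v)) * p v \<partial>lborel) \<partial>L)"
        unfolding Di
        by (intro nn_integral_cong, subst nn_integral_density) (auto simp: mult.commute)
      finally show "(\<integral>\<^sup>+X. G x X \<partial>PiM I D) =
        (\<integral>\<^sup>+X. (\<integral>\<^sup>+v. G x (X(i := v)) * p v \<partial>lborel) \<partial>L)" .
    qed
    finally show ?thesis .
  qed
  have p1: "(\<integral>\<^sup>+v. p v \<partial>lborel) = 1"
    using Di.emeasure_space_1 unfolding Di by (simp add: emeasure_density)
  have "(\<integral>\<^sup>+\<omega>. h (F (\<theta> \<omega>) (?W \<omega>)) (w i \<omega>) \<partial>M) = (\<integral>\<^sup>+\<omega>. h (F (\<theta> \<omega>) (?W \<omega>)) (?W \<omega> i) \<partial>M)"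
    using i by simp
  also have "\<dots> = (\<integral>\<^sup>+x. (\<integral>\<^sup>+X. (\<integral>\<^sup>+v. h (F x X) v * p v \<partial>lborel) \<partial>L) \<partial>distr M N \<theta>)"
    by (subst joint[of "\<lambda>x X. h (F x X) (X i)"]) (use i in \<open>auto simp: upd\<close>)
  \<comment> \<open>An idle integration over coordinate \<open>i\<close>, of total mass 1, is
    inserted so that \<open>joint\<close> can be read backwards for the inner integral.\<close>
  also have "\<dots> = (\<integral>\<^sup>+x. (\<integral>\<^sup>+X. (\<integral>\<^sup>+u. (\<integral>\<^sup>+v. h (F x X) v * p v \<partial>lborel) * p u \<partial>lborel) \<partial>L) \<partial>distr M N \<theta>)"
    by (simp add: nn_integral_cmult p1)
  also have "\<dots> = (\<integral>\<^sup>+\<omega>. (\<integral>\<^sup>+v. h (F (\<theta> \<omega>) (?W \<omega>)) v * p v \<partial>lborel) \<partial>M)"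
    by (subst joint[of "\<lambda>x X. \<integral>\<^sup>+v. h (F x X) v * p v \<partial>lborel"]) (auto simp: upd)
  finally show ?thesis .
qed

section \<open>Hitting probabilities of the prediction kernel\<close>

lemma density_ge_imp_measure_ge:
  assumes s: "0 < s" and [measurable]: "A \<in> sets borel" and fin: "emeasure lborel A < \<infinity>"
    and d: "0 \<le> d" "\<And>y. y \<in> A \<Longrightarrow> d \<le> normal_density 0 s y"
  shows "d * measure lborel A \<le> measure (density lborel (normal_density 0 s)) A"
proof -
  interpret N: prob_space "density lborel (normal_density 0 s)"
    using s by (rule prob_space_normal_density)
  have "ennreal (d * measure lborel A) = (\<integral>\<^sup>+y. ennreal d * indicator A y \<partial>lborel)"
    using fin d(1) by (simp add: nn_integral_cmult_indicator emeasure_eq_ennreal_measure ennreal_mult)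
  also have "\<dots> \<le> (\<integral>\<^sup>+y. ennreal (normal_density 0 s y) * indicator A y \<partial>lborel)"
    using d(2) by (intro nn_integral_mono) (auto simp: indicator_def intro: ennreal_leI)
  also have "\<dots> = ennreal (measure (density lborel (normal_density 0 s)) A)"
    by (simp add: emeasure_density flip: N.emeasure_eq_measure)
  finally show ?thesis by simp
qed

lemma normal_measure_ge_bounded:
  assumes "0 < \<sigma>" and [measurable]: "A \<in> sets borel" and A: "A \<subseteq> {-R..R}" "0 < measure lborel A"
  shows "\<exists>c>0. \<forall>s. \<sigma> \<le> s \<longrightarrow> s \<le> K \<longrightarrow> c \<le> measure (density lborel (normal_density 0 s)) A"
proof (cases "\<sigma> \<le> K")
  case True
  \<comment> \<open>Each factor of the density is replaced by its worst value: the normalisation at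
    \<open>s = K\<close>, the exponential at \<open>y = R\<close> and
    \<open>s = \<sigma>\<close>.\<close>
  define d where "d = 1 / sqrt (2 * pi * K\<^sup>2) * exp (- R\<^sup>2 / (2 * \<sigma>\<^sup>2))"
  have K: "K > 0" using True assms(1) by simp
  then have d0: "d > 0" by (simp add: d_def)
  have fin: "emeasure lborel A < \<infinity>"
    using emeasure_mono[OF A(1), of lborel] by (auto simp: emeasure_lborel_Icc_eq intro: le_less_trans)
  have "d * measure lborel A \<le> measure (density lborel (normal_density 0 s)) A"
    if s: "\<sigma> \<le> s" "s \<le> K" for s
  proof (rule density_ge_imp_measure_ge)
    fix y assume "y \<in> A"
    then have "y \<in> {-R..R}" using A(1) by blast
    then have "\<bar>y\<bar> \<le> \<bar>R\<bar>" by auto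
    then have y: "y\<^sup>2 \<le> R\<^sup>2" by (simp add: abs_le_square_iff)
    have "\<sigma>\<^sup>2 \<le> s\<^sup>2" using s assms(1) by (intro power_mono) auto
    then have "y\<^sup>2 / (2 * s\<^sup>2) \<le> R\<^sup>2 / (2 * \<sigma>\<^sup>2)"
      using y assms(1) by (intro frac_le) auto
    moreover have "1 / sqrt (2 * pi * K\<^sup>2) \<le> 1 / sqrt (2 * pi * s\<^sup>2)"
      using s assms(1) by (intro divide_left_mono real_sqrt_le_mono mult_left_mono power_mono) auto
    ultimately show "d \<le> normal_density 0 s y"
      unfolding d_def normal_density_def by (intro mult_mono) auto
  qed (use s assms(1) d0 fin in auto)
  then show ?thesis using d0 A(2) by (intro exI[of _ "d * measure lborel A"]) auto
\<comment> \<open>For \<open>K < \<sigma>\<close> no \<open>s\<close> qualifies and any positive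
  constant serves.\<close>
qed (auto intro: exI[of _ 1])

text \<open>For large \<open>s\<close> consider the window from \<open>-s\<close> to
  \<open>s\<close>: the density there is at least a multiple of \<open>1 / s\<close>, while
  \<open>A\<close> fills at least \<open>\<epsilon> * s\<close> of it, so \<open>s\<close> cancels.
  The remaining bounded range of \<open>s\<close> falls under the previous lemma.\<close>

lemma normal_measure_ge_dense:
  assumes \<sigma>: "0 < \<sigma>" and A [measurable]: "A \<in> sets borel"
    and lim: "Liminf at_top (\<lambda>l::real. ereal (measure lebesgue (A \<inter> {-l..l}) / l)) > 0"
  shows "\<exists>c>0. \<forall>s\<ge>\<sigma>. c \<le> measure (density lborel (normal_density 0 s)) A"
proof -
  obtain \<epsilon> where \<epsilon>: "0 < ereal \<epsilon>"
      "ereal \<epsilon> < Liminf at_top (\<lambda>l::real. ereal (measure lebesgue (A \<inter> {-l..l}) / l))"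
    using ereal_dense2[OF lim] by auto
  have "eventually (\<lambda>l::real. ereal \<epsilon> < ereal (measure lebesgue (A \<inter> {-l..l}) / l)) at_top"
    using less_LiminfD[OF \<epsilon>(2)] .
  then obtain l1 where l1: "\<And>l. l \<ge> l1 \<Longrightarrow> \<epsilon> < measure lebesgue (A \<inter> {-l..l}) / l"
    by (auto simp: eventually_at_top_linorder)
  \<comment> \<open>The maximum with \<open>\<sigma>\<close> makes the threshold positive.\<close>
  define l0 where "l0 = max l1 \<sigma>"
  have l0: "l0 > 0" using \<sigma> by (simp add: l0_def)
  have big: "\<epsilon> * l \<le> measure lborel (A \<inter> {-l..l})" if "l \<ge> l0" for l
    using l1[of l] that l0 by (simp add: l0_def field_simps)
  have fin: "emeasure lborel (A \<inter> {-l..l}) < \<infinity>" for l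
    using emeasure_mono[of "A \<inter> {-l..l}" "{-l..l}" lborel]
    by (auto simp: emeasure_lborel_Icc_eq intro: le_less_trans)
  have mono: "measure (density lborel (normal_density 0 s)) (A \<inter> {-l..l}) \<le>
      measure (density lborel (normal_density 0 s)) A" if "s > 0" for s l
  proof -
    interpret prob_space "density lborel (normal_density 0 s)"
      using that by (rule prob_space_normal_density)
    show ?thesis by (rule finite_measure_mono) auto
  qed
  have "0 < measure lborel (A \<inter> {-l0..l0})"
    using big[of l0] l0 \<epsilon>(1) by (auto intro: less_le_trans[rotated])
  then obtain c1 where c1: "c1 > 0"
      "\<And>s. \<sigma> \<le> s \<Longrightarrow> s \<le> l0 \<Longrightarrow> c1 \<le> measure (density lborel (normal_density 0 s)) (A \<inter> {-l0..l0})"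
    using normal_measure_ge_bounded[OF \<sigma>, of "A \<inter> {-l0..l0}" l0 l0] by auto
  define c2 where "c2 = exp (- 1 / 2) / sqrt (2 * pi) * \<epsilon>"
  have c2: "c2 > 0" using \<epsilon>(1) by (simp add: c2_def)
  have "c2 \<le> measure (density lborel (normal_density 0 s)) A" if s: "s \<ge> l0" for s
  proof -
    have s0: "s > 0" using s l0 by simp
    define d where "d = exp (- 1 / 2) / (sqrt (2 * pi) * s)"
    have "c2 = d * (\<epsilon> * s)" using s0 by (simp add: d_def c2_def)
    also have "\<dots> \<le> d * measure lborel (A \<inter> {-s..s})"
      using big[OF s] s0 by (intro mult_left_mono) (auto simp: d_def)
    also have "\<dots> \<le> measure (density lborel (normal_density 0 s)) (A \<inter> {-s..s})"
    proof (rule density_ge_imp_measure_ge)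
      fix y assume "y \<in> A \<inter> {-s..s}"
      then have "y\<^sup>2 \<le> s\<^sup>2" using s0 by (auto simp: abs_le_square_iff[symmetric])
      then have "y\<^sup>2 / (2 * s\<^sup>2) \<le> 1 / 2" using s0 by (simp add: field_simps)
      then show "d \<le> normal_density 0 s y"
        using s0 unfolding d_def normal_density_def
        by (simp add: real_sqrt_mult divide_right_mono)
    qed (use s0 fin in \<open>auto simp: d_def\<close>)
    also note mono[OF s0]
    finally show ?thesis .
  qed
  moreover have "c1 \<le> measure (density lborel (normal_density 0 s)) A" if "\<sigma> \<le> s" "s \<le> l0" for s
    using c1(2)[OF that] mono[of s l0] that \<sigma> by linarith
  ultimately have "\<forall>s\<ge>\<sigma>. min c1 c2 \<le> measure (density lborel (normal_density 0 s)) A"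
    by (metis linear min.coboundedI1 min.coboundedI2)
  then show ?thesis using c1(1) c2 by (intro exI[of _ "min c1 c2"]) auto
qed

lemma nn_integral_normal_one_minus_indicator:
  assumes s: "0 < s" and [measurable]: "A \<in> sets borel" and q: "0 \<le> q" "q \<le> 1"
    and c: "c \<le> measure (density lborel (normal_density 0 s)) A"
  shows "(\<integral>\<^sup>+y. ennreal (1 - q * indicator A y) * ennreal (normal_density 0 s y) \<partial>lborel) \<le>
    ennreal (1 - q * c)"
proof -
  let ?N = "density lborel (normal_density 0 s)"
  interpret N: prob_space ?N using s by (rule prob_space_normal_density)
  have int: "integrable ?N (\<lambda>_. 1 :: real)" "integrable ?N (\<lambda>y. q * indicator A y)"
    by (auto intro!: integrable_mult_right integrable_real_indicator simp: less_top[symmetric])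
  have "(\<integral>\<^sup>+y. ennreal (1 - q * indicator A y) * ennreal (normal_density 0 s y) \<partial>lborel) =
      (\<integral>\<^sup>+y. ennreal (1 - q * indicator A y) \<partial>?N)"
    by (subst nn_integral_density) (auto simp: mult.commute)
  also have "\<dots> = ennreal (\<integral>y. 1 - q * indicator A y \<partial>?N)"
    using q by (intro nn_integral_eq_integral Bochner_Integration.integrable_diff int)
      (auto simp: indicator_def)
  also have "(\<integral>y. 1 - q * indicator A y \<partial>?N) = 1 - q * measure ?N A"
    using N.prob_space by (simp add: Bochner_Integration.integral_diff[OF int])
  also have "ennreal \<dots> \<le> ennreal (1 - q * c)"
    using c q by (intro ennreal_leI) (simp add: mult_left_mono)
  finally show ?thesis .
qed

text \<open>Markov's inequality bounds the probability of \<open>1 \<le> X t\<close> by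
  \<open>a t\<close>, and the Borel--Cantelli lemma applies.\<close>

lemma (in prob_space) AE_eventually_less_1:
  fixes X :: "nat \<Rightarrow> 'a \<Rightarrow> real"
  assumes [measurable]: "\<And>t. X t \<in> borel_measurable M"
    and a: "\<And>t. 0 \<le> a t" "summable a"
    and le: "\<And>t. (\<integral>\<^sup>+\<omega>. ennreal (X t \<omega>) \<partial>M) \<le> ennreal (a t)"
  shows "AE \<omega> in M. eventually (\<lambda>t. X t \<omega> < 1) sequentially"
proof -
  define A where "A = (\<lambda>t. {\<omega> \<in> space M. 1 \<le> X t \<omega>})"
  have [measurable]: "A t \<in> events" for t unfolding A_def by measurable
  have "prob (A t) \<le> a t" for t
  proof -
    have "emeasure M (A t) = (\<integral>\<^sup>+\<omega>. indicator (A t) \<omega> \<partial>M)" by simp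
    also have "\<dots> \<le> (\<integral>\<^sup>+\<omega>. ennreal (X t \<omega>) \<partial>M)"
      by (intro nn_integral_mono) (auto simp: A_def indicator_def)
    also note le[of t]
    finally show ?thesis using a(1)[of t] by (simp add: emeasure_eq_measure)
  qed
  then have "summable (\<lambda>t. prob (A t))"
    using a(2) by (intro summable_comparison_test[of "\<lambda>t. prob (A t)" a]) auto
  then have "AE \<omega> in M. eventually (\<lambda>t. \<omega> \<in> space M - A t) sequentially"
    by (intro borel_cantelli_AE1) (auto simp: less_top[symmetric])
  then show ?thesis
    by eventually_elim (auto simp: A_def elim: eventually_mono)
qed

section \<open>Discounted visit counts under the kernel\<close>

context ls_loop
begin

text \<open>The exponential of minus the number of visits to \<open>B\<close>, prepared for a
  Chernoff bound. Since \<open>cnt\<close> leaves out the last output, its visit is added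
  here.\<close>

definition disc :: "'n lstate \<Rightarrow> real" where
  "disc S = exp (- (cnt S + indicator B (obs S)))"

lemma disc_measurable [measurable]: "disc \<in> borel_measurable borel"
  unfolding disc_def[abs_def] by measurable

lemma disc_step: "disc (step S y) = disc S * (1 - (1 - exp (- 1)) * indicator B y)"
proof -
  have "disc (step S y) = disc S * exp (- indicator B y)"
    by (simp add: disc_def step_def exp_add[symmetric])
  then show ?thesis by (simp add: indicator_def)
qed

lemma sqrt_innov_var_ge: "valid S \<Longrightarrow> \<sigma> \<le> sqrt (innov_var S)"
  using innov_var_ge[of S] sigma_pos by (simp add: real_le_rsqrt)

lemma kern_disc:
  assumes S: "valid S" and c: "c \<le> measure (density lborel (normal_density 0 (sqrt (innov_var S)))) B"
  shows "kern (\<lambda>S. ennreal (disc S)) S \<le> ennreal (disc S * (1 - (1 - exp (- 1)) * c))"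
proof -
  let ?n = "\<lambda>y. ennreal (normal_density 0 (sqrt (innov_var S)) y)"
  have d0: "0 \<le> disc S" by (simp add: disc_def)
  have "kern (\<lambda>S. ennreal (disc S)) S =
      (\<integral>\<^sup>+y. ennreal (disc S) * (ennreal (1 - (1 - exp (- 1)) * indicator B y) * ?n y) \<partial>lborel)"
    unfolding kern_def disc_step
    by (intro nn_integral_cong) (auto simp: ennreal_mult d0 indicator_def mult.assoc)
  also have "\<dots> = ennreal (disc S) *
      (\<integral>\<^sup>+y. ennreal (1 - (1 - exp (- 1)) * indicator B y) * ?n y \<partial>lborel)"
    by (rule nn_integral_cmult) measurable
  also have "\<dots> \<le> ennreal (disc S) * ennreal (1 - (1 - exp (- 1)) * c)"
    using innov_var_pos[OF S] c
    by (intro mult_left_mono nn_integral_normal_one_minus_indicator) auto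
  finally show ?thesis by (simp add: ennreal_mult' d0)
qed

text \<open>Two steps are needed: the first one lands with probability at least \<open>c1\<close> in the region
  where \<open>\<phi>\<close> is bounded by \<open>L\<close>, which keeps the variance of the second one bounded.\<close>

lemma kern_kern_disc:
  assumes S: "valid S"
    and c1: "\<And>s. \<sigma> \<le> s \<Longrightarrow> c1 \<le> measure (density lborel (normal_density 0 s)) {x. norm (\<phi> x) \<le> L}"
    and c2: "\<And>s. \<sigma> \<le> s \<Longrightarrow> s \<le> sqrt (\<sigma>\<^sup>2 + L\<^sup>2) \<Longrightarrow>
      c2 \<le> measure (density lborel (normal_density 0 s)) B" "0 \<le> c2" "c2 \<le> 1"
  shows "kern (kern (\<lambda>S. ennreal (disc S))) S \<le> ennreal (disc S * (1 - (1 - exp (- 1)) * c2 * c1))"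
proof -
  let ?n = "\<lambda>y. ennreal (normal_density 0 (sqrt (innov_var S)) y)"
  let ?q = "(1 - exp (- 1)) * c2"
  define A where "A = {x. norm (\<phi> x) \<le> L}"
  have [measurable]: "A \<in> sets borel" unfolding A_def by measurable
  have e1: "0 \<le> 1 - exp (- 1 :: real)" "1 - exp (- 1 :: real) \<le> 1" by auto
  then have q: "0 \<le> ?q" "?q \<le> 1" using c2(2,3) by (auto intro: mult_le_one)
  have d0: "0 \<le> disc T" for T by (simp add: disc_def)
  \<comment> \<open>The variance of the next output is bounded only if the current output lies in
    \<open>A\<close>; elsewhere the trivial hitting probability 0 is used.\<close>
  have 1: "kern (\<lambda>S. ennreal (disc S)) T \<le> ennreal (disc T * (1 - ?q * indicator A (obs T)))"
    if T: "valid T" for T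
  proof (cases "obs T \<in> A")
    case True
    then have "sqrt (innov_var T) \<le> sqrt (\<sigma>\<^sup>2 + L\<^sup>2)"
      using innov_var_le[OF T, of L] by (simp add: A_def)
    then show ?thesis
      using kern_disc[OF T c2(1)[OF sqrt_innov_var_ge[OF T]]] True by (simp add: mult.assoc)
  next
    case False
    then show ?thesis using kern_disc[OF T, of 0] by simp
  qed
  \<comment> \<open>A visit at the intermediate time can only lower \<open>disc\<close>. It is
    therefore ignored, and just the gain of the second step is averaged over the first
    output.\<close>
  have le: "disc (step S y) \<le> disc S" for y
    using e1 d0[of S] by (simp add: disc_step indicator_def mult_left_le)
  have obs: "obs (step S y) = y" for y by (simp add: step_def)
  have "kern (kern (\<lambda>S. ennreal (disc S))) S \<le>
      (\<integral>\<^sup>+y. ennreal (disc S) * (ennreal (1 - ?q * indicator A y) * ?n y) \<partial>lborel)"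
    unfolding kern_def[of "kern _"]
  proof (rule nn_integral_mono)
    fix y
    have "kern (\<lambda>S. ennreal (disc S)) (step S y) \<le>
        ennreal (disc (step S y) * (1 - ?q * indicator A y))"
      using 1[OF valid_step[OF S, of y]] by (simp add: obs)
    also have "\<dots> \<le> ennreal (disc S * (1 - ?q * indicator A y))"
      using q by (intro ennreal_leI mult_right_mono le) (auto simp: indicator_def)
    finally show "kern (\<lambda>S. ennreal (disc S)) (step S y) * ?n y \<le>
        ennreal (disc S) * (ennreal (1 - ?q * indicator A y) * ?n y)"
      by (auto simp: ennreal_mult' d0 mult.assoc[symmetric] intro: mult_right_mono)
  qed
  also have "\<dots> = ennreal (disc S) * (\<integral>\<^sup>+y. ennreal (1 - ?q * indicator A y) * ?n y \<partial>lborel)"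
    by (rule nn_integral_cmult) measurable
  also have "\<dots> \<le> ennreal (disc S) * ennreal (1 - ?q * c1)"
    using innov_var_pos[OF S] c1[OF sqrt_innov_var_ge[OF S]] q
    by (intro mult_left_mono nn_integral_normal_one_minus_indicator) (auto simp: A_def[symmetric])
  finally show ?thesis by (simp add: ennreal_mult' d0)
qed

end

section \<open>Estimation error and excitation along the process\<close>

text \<open>The closed loop seen through test functions instead of conditional laws:
  \<open>prior\<close> says that \<open>\<theta>\<close> starts with the law encoded in the state,
  \<open>transition\<close> that given \<open>\<theta>\<close> and the state the next output is
  normal with mean \<open>(\<theta> - est) \<bullet> \<phi>\<close> and variance
  \<open>\<sigma>\<^sup>2\<close>. The set \<open>B\<close> stays a parameter because several sets
  are used later.\<close>

locale ls_process = ls_loop \<phi> \<sigma> B + prob_space M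
  for \<phi> :: "real \<Rightarrow> real ^ 'n::finite" and \<sigma> :: real and B :: "real set" and M :: "'a measure" +
  fixes \<theta> :: "'a \<Rightarrow> real ^ 'n" and S :: "nat \<Rightarrow> 'a \<Rightarrow> 'n lstate"
  assumes theta_measurable [measurable]: "\<theta> \<in> borel_measurable M"
    and S_measurable [measurable]: "\<And>t. S t \<in> borel_measurable M"
    and valid_init: "\<And>\<omega>. \<omega> \<in> space M \<Longrightarrow> valid (S 0 \<omega>)"
    and cnt_init: "\<And>\<omega>. \<omega> \<in> space M \<Longrightarrow> cnt (S 0 \<omega>) = 0"
    and S_step: "\<And>t \<omega>. \<omega> \<in> space M \<Longrightarrow> \<exists>y. S (Suc t) \<omega> = step (S t \<omega>) y"
    and prior: "\<And>g. case_prod g \<in> borel_measurable (borel \<Otimes>\<^sub>M borel) \<Longrightarrow>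
      (\<integral>\<^sup>+\<omega>. g (\<theta> \<omega>) (S 0 \<omega>) \<partial>M) = (\<integral>\<^sup>+\<omega>. post g (S 0 \<omega>) \<partial>M)"
    and transition: "\<And>g t. case_prod g \<in> borel_measurable (borel \<Otimes>\<^sub>M borel) \<Longrightarrow>
      (\<integral>\<^sup>+\<omega>. g (\<theta> \<omega>) (S (Suc t) \<omega>) \<partial>M) =
      (\<integral>\<^sup>+\<omega>. (\<integral>\<^sup>+y. g (\<theta> \<omega>) (step (S t \<omega>) y) * ennreal (normal_density 0 \<sigma>
        (y - (\<theta> \<omega> - est (S t \<omega>)) \<bullet> \<phi> (obs (S t \<omega>)))) \<partial>lborel) \<partial>M)"
begin

lemma valid_S: "\<omega> \<in> space M \<Longrightarrow> valid (S t \<omega>)"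
proof (induction t)
  case (Suc t)
  then show ?case using S_step[of \<omega> t] valid_step by metis
qed (rule valid_init)

text \<open>Induction over all test functions at once: \<open>transition\<close> turns a test
  function at time \<open>t + 1\<close> into a different one at time \<open>t\<close>, to which the
  induction hypothesis applies.\<close>

lemma bayes:
  assumes "case_prod g \<in> borel_measurable (borel \<Otimes>\<^sub>M borel)"
  shows "(\<integral>\<^sup>+\<omega>. g (\<theta> \<omega>) (S t \<omega>) \<partial>M) = (\<integral>\<^sup>+\<omega>. post g (S t \<omega>) \<partial>M)"
  using assms
proof (induction t arbitrary: g)
  case 0
  then show ?case by (rule prior)
next
  case (Suc t)
  have step: "(\<integral>\<^sup>+\<omega>. h (\<theta> \<omega>) (S (Suc t) \<omega>) \<partial>M) = (\<integral>\<^sup>+\<omega>. kern (post h) (S t \<omega>) \<partial>M)"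
    if [measurable]: "case_prod h \<in> borel_measurable (borel \<Otimes>\<^sub>M borel)" for h
  proof -
    have "(\<integral>\<^sup>+\<omega>. h (\<theta> \<omega>) (S (Suc t) \<omega>) \<partial>M) =
        (\<integral>\<^sup>+\<omega>. post (\<lambda>\<theta> S. \<integral>\<^sup>+y. h \<theta> (step S y) *
          ennreal (normal_density 0 \<sigma> (y - (\<theta> - est S) \<bullet> \<phi> (obs S))) \<partial>lborel) (S t \<omega>) \<partial>M)"
      unfolding transition[OF that]
      by (rule Suc.IH) (unfold normal_density_def, measurable)
    also have "\<dots> = (\<integral>\<^sup>+\<omega>. kern (post h) (S t \<omega>) \<partial>M)"
      by (intro nn_integral_cong post_step[OF valid_S that])
    finally show ?thesis .
  qed
  note [measurable] = Suc.prems
  \<comment> \<open>The right-hand side is itself the expectation of a function of the state, so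
    \<open>step\<close> applies to it too; a second posterior average changes nothing by
    \<open>post_const\<close>.\<close>
  have "(\<integral>\<^sup>+\<omega>. post g (S (Suc t) \<omega>) \<partial>M) = (\<integral>\<^sup>+\<omega>. kern (post (\<lambda>_. post g)) (S t \<omega>) \<partial>M)"
    by (rule step[of "\<lambda>_. post g"]) measurable
  also have "\<dots> = (\<integral>\<^sup>+\<omega>. kern (post g) (S t \<omega>) \<partial>M)"
    by (intro nn_integral_cong) (simp add: kern_def post_const valid_step valid_S)
  also have "\<dots> = (\<integral>\<^sup>+\<omega>. g (\<theta> \<omega>) (S (Suc t) \<omega>) \<partial>M)"
    by (rule step[symmetric]) (rule Suc.prems)
  finally show ?case ..
qed

text \<open>For functions of the state alone the posterior average over \<open>\<theta>\<close>
  leaves only the predictive law, so the state evolves by \<open>kern\<close> without reference to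
  \<open>\<theta>\<close>.\<close>

lemma markov:
  assumes [measurable]: "f \<in> borel_measurable borel"
  shows "(\<integral>\<^sup>+\<omega>. f (S (Suc t) \<omega>) \<partial>M) = (\<integral>\<^sup>+\<omega>. kern f (S t \<omega>) \<partial>M)"
proof -
  have "(\<integral>\<^sup>+\<omega>. f (S (Suc t) \<omega>) \<partial>M) = (\<integral>\<^sup>+\<omega>. post (\<lambda>\<theta> S. \<integral>\<^sup>+y. f (step S y) *
      ennreal (normal_density 0 \<sigma> (y - (\<theta> - est S) \<bullet> \<phi> (obs S))) \<partial>lborel) (S t \<omega>) \<partial>M)"
    by (subst transition[where g = "\<lambda>_. f"], measurable, rule bayes, unfold normal_density_def, measurable)
  also have "\<dots> = (\<integral>\<^sup>+\<omega>. kern (post (\<lambda>_. f)) (S t \<omega>) \<partial>M)"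
    by (intro nn_integral_cong post_step[where g = "\<lambda>_. f"] valid_S) measurable
  also have "\<dots> = (\<integral>\<^sup>+\<omega>. kern f (S t \<omega>) \<partial>M)"
    by (intro nn_integral_cong) (simp add: kern_def post_const valid_step valid_S)
  finally show ?thesis .
qed

section \<open>Logarithmic growth of the error form\<close>

definition err :: "nat \<Rightarrow> 'a \<Rightarrow> real" where
  "err t \<omega> = (\<theta> \<omega> - est (S t \<omega>)) \<bullet> (prec (S t \<omega>) *v (\<theta> \<omega> - est (S t \<omega>)))"

lemma err_measurable [measurable]: "err t \<in> borel_measurable M"
  unfolding err_def[abs_def] by measurable

text \<open>Under the posterior law the error form has a \<open>\<chi>\<^sup>2\<close> distribution with \<open>n\<close> degrees of freedom,
  so its exponential moments of order below \<open>1/2\<close> do not depend on \<open>t\<close>.\<close>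

lemma exp_moment_err:
  "(\<integral>\<^sup>+\<omega>. ennreal (exp (err t \<omega> / 4)) \<partial>M) = ennreal (sqrt 2 ^ CARD('n))"
proof -
  define g where "g = (\<lambda>\<theta> S :: 'n lstate. ennreal (exp ((\<theta> - est S) \<bullet> (prec S *v (\<theta> - est S)) / 4)))"
  have [measurable]: "case_prod g \<in> borel_measurable (borel \<Otimes>\<^sub>M borel)"
    unfolding g_def by measurable
  have post: "post g T = ennreal (sqrt 2 ^ CARD('n))" if T: "valid T" for T
  proof -
    let ?f = "\<lambda>x. ennreal (exp (- (x \<bullet> (prec T *v x)) / 4))"
    have "(\<integral>\<^sup>+\<theta>. g \<theta> T * ennreal (dens T \<theta>) \<partial>lborel) = (\<integral>\<^sup>+\<theta>. ?f (\<theta> - est T) \<partial>lborel)"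
      unfolding g_def dens_def
      by (intro nn_integral_cong) (simp add: ennreal_mult[symmetric] exp_add[symmetric])
    also have "\<dots> = (\<integral>\<^sup>+x. ?f x \<partial>lborel)"
      by (rule nn_integral_lborel_translate[where f = ?f]) measurable
    \<comment> \<open>Stretching by \<open>sqrt 2\<close> doubles the quadratic form, which turns
      the exponent of \<open>?f\<close> into that of \<open>mass T\<close>.\<close>
    also have "\<dots> = ennreal (sqrt 2 ^ CARD('n)) * (\<integral>\<^sup>+x. ?f (sqrt 2 *\<^sub>R x) \<partial>lborel)"
      by (subst nn_integral_lborel_scale[of ?f "sqrt 2"]) auto
    also have "(\<integral>\<^sup>+x. ?f (sqrt 2 *\<^sub>R x) \<partial>lborel) = mass T"
      unfolding mass_eq_prec
      by (intro nn_integral_cong) (simp add: matrix_vector_mult_scaleR)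
    finally show ?thesis
      unfolding post_def using mass_pos[of T] mass_finite[OF T] by (simp add: ennreal_mult_divide_eq)
  qed
  have "(\<integral>\<^sup>+\<omega>. ennreal (exp (err t \<omega> / 4)) \<partial>M) = (\<integral>\<^sup>+\<omega>. g (\<theta> \<omega>) (S t \<omega>) \<partial>M)"
    by (simp add: g_def err_def)
  also have "\<dots> = (\<integral>\<^sup>+\<omega>. post g (S t \<omega>) \<partial>M)"
    by (rule bayes) measurable
  also have "\<dots> = (\<integral>\<^sup>+\<omega>. ennreal (sqrt 2 ^ CARD('n)) \<partial>M)"
    by (intro nn_integral_cong post valid_S)
  finally show ?thesis by (simp add: emeasure_space_1)
qed

lemma AE_err_le: "AE \<omega> in M. eventually (\<lambda>t. err t \<omega> \<le> 8 * ln (real t + 1)) sequentially"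
proof -
  let ?C = "sqrt 2 ^ CARD('n) :: real"
  \<comment> \<open>The weight is summable and costs \<open>2 * ln (t + 1)\<close> against
    \<open>err / 4\<close>; hence the constant 8.\<close>
  define X where "X = (\<lambda>t \<omega>. 1 / (real t + 1)\<^sup>2 * exp (err t \<omega> / 4))"
  have "AE \<omega> in M. eventually (\<lambda>t. X t \<omega> < 1) sequentially"
  proof (rule AE_eventually_less_1)
    show "X t \<in> borel_measurable M" for t unfolding X_def by measurable
    show "0 \<le> ?C * (1 / (real t + 1)\<^sup>2)" for t by simp
    have "summable (\<lambda>t. 1 / (real (Suc t))\<^sup>2)"
      using inverse_power_summable[of 2, where 'a = real]
      by (subst summable_Suc_iff) (simp add: inverse_eq_divide)
    then show "summable (\<lambda>t. ?C * (1 / (real t + 1)\<^sup>2))"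
      by (intro summable_mult) (simp add: add.commute)
    show "(\<integral>\<^sup>+\<omega>. ennreal (X t \<omega>) \<partial>M) \<le> ennreal (?C * (1 / (real t + 1)\<^sup>2))" for t
    proof -
      have "(\<integral>\<^sup>+\<omega>. ennreal (X t \<omega>) \<partial>M) =
          (\<integral>\<^sup>+\<omega>. ennreal (1 / (real t + 1)\<^sup>2) * ennreal (exp (err t \<omega> / 4)) \<partial>M)"
        unfolding X_def by (intro nn_integral_cong ennreal_mult) auto
      also have "\<dots> = ennreal (1 / (real t + 1)\<^sup>2) * ennreal ?C"
        by (subst nn_integral_cmult) (measurable, simp only: exp_moment_err)
      also have "\<dots> = ennreal (?C * (1 / (real t + 1)\<^sup>2))"
        by (subst ennreal_mult[symmetric]) (auto simp: mult.commute)
      finally show ?thesis by simp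
    qed
  qed
  then show ?thesis
  proof eventually_elim
    case (elim \<omega>)
    then show ?case
    proof eventually_elim
      case (elim t)
      then have "exp (err t \<omega> / 4) < (real t + 1)\<^sup>2"
        by (simp add: X_def field_simps)
      then have "ln (exp (err t \<omega> / 4)) < ln ((real t + 1)\<^sup>2)"
        by (subst ln_less_cancel_iff) auto
      then show ?case by (simp add: ln_realpow)
    qed
  qed
qed

section \<open>Visit frequency of \<open>B\<close> and growth of the precision\<close>

lemma disc_decay:
  assumes c1: "\<And>s. \<sigma> \<le> s \<Longrightarrow> c1 \<le> measure (density lborel (normal_density 0 s)) {x. norm (\<phi> x) \<le> L}"
    and c2: "\<And>s. \<sigma> \<le> s \<Longrightarrow> s \<le> sqrt (\<sigma>\<^sup>2 + L\<^sup>2) \<Longrightarrow>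
      c2 \<le> measure (density lborel (normal_density 0 s)) B" "0 \<le> c2" "c2 \<le> 1"
    and \<rho>: "0 \<le> \<rho>" "1 - (1 - exp (- 1)) * c2 * c1 \<le> \<rho>"
  shows "(\<integral>\<^sup>+\<omega>. ennreal (disc (S (2 * j) \<omega>)) \<partial>M) \<le> ennreal (\<rho> ^ j)"
proof (induction j)
  case 0
  have "(\<integral>\<^sup>+\<omega>. ennreal (disc (S 0 \<omega>)) \<partial>M) \<le> (\<integral>\<^sup>+\<omega>. ennreal 1 \<partial>M)"
    by (intro nn_integral_mono ennreal_leI) (simp add: disc_def cnt_init)
  then show ?case by (simp add: emeasure_space_1)
next
  case (Suc j)
  \<comment> \<open>The Markov property is used twice, to match the two-step contraction; this is
    why only even times are treated.\<close>
  have "(\<integral>\<^sup>+\<omega>. ennreal (disc (S (2 * Suc j) \<omega>)) \<partial>M) =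
      (\<integral>\<^sup>+\<omega>. kern (kern (\<lambda>S. ennreal (disc S))) (S (2 * j) \<omega>) \<partial>M)"
    using markov[of "\<lambda>S. ennreal (disc S)" "Suc (2 * j)"] markov[of "kern (\<lambda>S. ennreal (disc S))" "2 * j"]
    by simp
  also have "\<dots> \<le> (\<integral>\<^sup>+\<omega>. ennreal \<rho> * ennreal (disc (S (2 * j) \<omega>)) \<partial>M)"
  proof (rule nn_integral_mono)
    fix \<omega> assume "\<omega> \<in> space M"
    note kern_kern_disc[OF valid_S[OF this, of "2 * j"] c1 c2]
    also have "ennreal (disc (S (2 * j) \<omega>) * (1 - (1 - exp (- 1)) * c2 * c1)) \<le>
        ennreal (disc (S (2 * j) \<omega>) * \<rho>)"
      using \<rho>(2) by (intro ennreal_leI mult_left_mono) (auto simp: disc_def)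
    also have "\<dots> = ennreal \<rho> * ennreal (disc (S (2 * j) \<omega>))"
      using \<rho>(1) by (simp add: ennreal_mult' mult.commute)
    finally show "kern (kern (\<lambda>S. ennreal (disc S))) (S (2 * j) \<omega>) \<le>
        ennreal \<rho> * ennreal (disc (S (2 * j) \<omega>))" by simp
  qed
  also have "\<dots> = ennreal \<rho> * (\<integral>\<^sup>+\<omega>. ennreal (disc (S (2 * j) \<omega>)) \<partial>M)"
    by (rule nn_integral_cmult) measurable
  also have "\<dots> \<le> ennreal \<rho> * ennreal (\<rho> ^ j)"
    by (intro mult_left_mono Suc.IH) auto
  finally show ?case using \<rho>(1) by (simp add: ennreal_mult)
qed

lemma cnt_Suc: "\<omega> \<in> space M \<Longrightarrow> cnt (S (Suc t) \<omega>) = cnt (S t \<omega>) + indicator B (obs (S t \<omega>))"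
  using S_step[of \<omega> t] by (auto simp: step_def)

lemma cnt_mono: "\<omega> \<in> space M \<Longrightarrow> s \<le> t \<Longrightarrow> cnt (S s \<omega>) \<le> cnt (S t \<omega>)"
  by (rule lift_Suc_mono_le[of "\<lambda>t. cnt (S t \<omega>)"]) (auto simp: cnt_Suc)

text \<open>A Chernoff argument: the exponential moment of minus the visit count decays
  geometrically, so having too few visits is an event of summable probability.\<close>

lemma AE_cnt_ge:
  assumes L: "Liminf at_top
      (\<lambda>l::real. ereal (measure lebesgue ({x. norm (\<phi> x) \<le> L} \<inter> {-l..l}) / l)) > 0"
    and B: "B \<subseteq> {-R..R}" "0 < measure lborel B"
  shows "\<exists>\<kappa>>0. AE \<omega> in M. eventually (\<lambda>t. \<kappa> * real t \<le> cnt (S t \<omega>)) sequentially"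
proof -
  obtain c1 where c1: "c1 > 0"
      "\<And>s. \<sigma> \<le> s \<Longrightarrow> c1 \<le> measure (density lborel (normal_density 0 s)) {x. norm (\<phi> x) \<le> L}"
    using normal_measure_ge_dense[OF sigma_pos _ L] by auto
  obtain c2 where c2: "c2 > 0" "\<And>s. \<sigma> \<le> s \<Longrightarrow> s \<le> sqrt (\<sigma>\<^sup>2 + L\<^sup>2) \<Longrightarrow>
      c2 \<le> measure (density lborel (normal_density 0 s)) B"
    using normal_measure_ge_bounded[OF sigma_pos B_measurable B] by blast
  interpret N: prob_space "density lborel (normal_density 0 \<sigma>)"
    using sigma_pos by (rule prob_space_normal_density)
  have "\<sigma> \<le> sqrt (\<sigma>\<^sup>2 + L\<^sup>2)" using sigma_pos by (intro real_le_rsqrt) simp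
  then have c2_le: "c2 \<le> 1" using order_trans[OF c2(2) N.prob_le_1] by simp
  \<comment> \<open>The maximum with \<open>1 / 2\<close> keeps \<open>\<rho>\<close> positive, so
    that its logarithm can be used.\<close>
  define \<rho> where "\<rho> = max (1 / 2) (1 - (1 - exp (- 1)) * c2 * c1)"
  have "0 < (1 - exp (- 1)) * c2 * c1" using c1(1) c2(1) by simp
  then have \<rho>: "0 < \<rho>" "\<rho> < 1" by (auto simp: \<rho>_def)
  \<comment> \<open>As \<open>\<rho> = exp (- 2 * k)\<close>, half of the decay pays for a visit
    rate of \<open>k\<close> per two steps and the other half for summability.\<close>
  define k where "k = - ln \<rho> / 2"
  have k: "k > 0" using \<rho> by (simp add: k_def)
  have ek: "exp k * \<rho> = exp (- k)"
  proof -
    have "\<rho> = exp (- (2 * k))" using \<rho> by (simp add: k_def)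
    then show ?thesis by (simp add: exp_add[symmetric])
  qed
  have "AE \<omega> in M. eventually (\<lambda>j. exp k ^ j * disc (S (2 * j) \<omega>) < 1) sequentially"
  proof (rule AE_eventually_less_1)
    show "summable (\<lambda>j. exp (- k) ^ j)" using k by (intro summable_geometric) simp
    show "(\<integral>\<^sup>+\<omega>. ennreal (exp k ^ j * disc (S (2 * j) \<omega>)) \<partial>M) \<le> ennreal (exp (- k) ^ j)" for j
    proof -
      have "(\<integral>\<^sup>+\<omega>. ennreal (exp k ^ j * disc (S (2 * j) \<omega>)) \<partial>M) =
          (\<integral>\<^sup>+\<omega>. ennreal (exp k ^ j) * ennreal (disc (S (2 * j) \<omega>)) \<partial>M)"
        by (intro nn_integral_cong ennreal_mult) (auto simp: disc_def)
      also have "\<dots> = ennreal (exp k ^ j) * (\<integral>\<^sup>+\<omega>. ennreal (disc (S (2 * j) \<omega>)) \<partial>M)"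
        by (rule nn_integral_cmult) measurable
      also have "\<dots> \<le> ennreal (exp k ^ j) * ennreal (\<rho> ^ j)"
        using c1 c2 c2_le \<rho>
        by (intro mult_left_mono disc_decay[where ?c1.0 = c1 and ?c2.0 = c2 and L = L])
          (auto simp: \<rho>_def)
      also have "\<dots> = ennreal (exp (- k) ^ j)"
        using \<rho> by (simp add: ennreal_mult[symmetric] power_mult_distrib[symmetric] ek)
      finally show ?thesis .
    qed
  qed auto
  then have "AE \<omega> in M. eventually (\<lambda>t. k / 4 * real t \<le> cnt (S t \<omega>)) sequentially"
  proof (rule AE_mp, intro AE_I2 impI)
    fix \<omega> assume \<omega>: "\<omega> \<in> space M"
      and "eventually (\<lambda>j. exp k ^ j * disc (S (2 * j) \<omega>) < 1) sequentially"
    then obtain j0 where j0: "\<And>j. j \<ge> j0 \<Longrightarrow> exp k ^ j * disc (S (2 * j) \<omega>) < 1"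
      by (auto simp: eventually_sequentially)
    have "k / 4 * real t \<le> cnt (S t \<omega>)" if t: "t \<ge> 2 * j0 + 4" for t
    proof -
      \<comment> \<open>\<open>disc\<close> at time \<open>2 * j\<close> includes the visit of that
        time and so corresponds to \<open>cnt\<close> at \<open>2 * j + 1\<close>, which must not
        exceed \<open>t\<close>; hence the \<open>t - 1\<close>.\<close>
      define j where "j = (t - 1) div 2"
      have j: "j \<ge> j0" "Suc (2 * j) \<le> t" "real t \<le> 4 * real j" using t by (auto simp: j_def)
      have "exp (real j * k - cnt (S (Suc (2 * j)) \<omega>)) < 1"
        using j0[OF j(1)]
        by (simp add: disc_def cnt_Suc[OF \<omega>] exp_of_nat_mult[symmetric] exp_add[symmetric] algebra_simps)
      then have "k * real j < cnt (S (Suc (2 * j)) \<omega>)" by (simp add: mult.commute)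
      also have "\<dots> \<le> cnt (S t \<omega>)" by (rule cnt_mono[OF \<omega> j(2)])
      finally have "k * real j < cnt (S t \<omega>)" .
      moreover have "k / 4 * real t \<le> k * real j" using j(3) k by (simp add: field_simps)
      ultimately show ?thesis by linarith
    qed
    then show "eventually (\<lambda>t. k / 4 * real t \<le> cnt (S t \<omega>)) sequentially"
      by (auto simp: eventually_sequentially)
  qed
  then show ?thesis using k by (intro exI[of _ "k / 4"]) simp
qed

text \<open>Each visit to \<open>B\<close> adds at least
  \<open>(\<delta> * norm x / \<sigma>)\<^sup>2\<close> to the quadratic form, and every other
  output adds a nonnegative amount.\<close>

lemma prec_ge_cnt:
  assumes \<omega>: "\<omega> \<in> space M" and \<delta>: "0 \<le> \<delta>" "\<And>y. y \<in> B \<Longrightarrow> \<delta> * norm x \<le> \<bar>x \<bullet> \<phi> y\<bar>"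
  shows "(\<delta> * norm x / \<sigma>)\<^sup>2 * cnt (S t \<omega>) \<le> x \<bullet> (prec (S t \<omega>) *v x)"
proof (induction t)
  case 0
  show ?case
    using order_trans[OF inner_ge_zero validD(7)[OF valid_init[OF \<omega>], of x]] by (simp add: cnt_init[OF \<omega>])
next
  case (Suc t)
  let ?y = "obs (S t \<omega>)"
  obtain y where y: "S (Suc t) \<omega> = step (S t \<omega>) y" using S_step[OF \<omega>] by blast
  have prec: "x \<bullet> (prec (S (Suc t) \<omega>) *v x) = x \<bullet> (prec (S t \<omega>) *v x) + (x \<bullet> \<phi> ?y / \<sigma>)\<^sup>2"
    unfolding y step_prec_mult
    by (simp add: inner_add_right inner_commute[of "\<phi> _" x] power2_eq_square)
  have "(\<delta> * norm x / \<sigma>)\<^sup>2 * indicator B ?y \<le> (x \<bullet> \<phi> ?y / \<sigma>)\<^sup>2"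
  proof (cases "?y \<in> B")
    case True
    have "\<bar>\<delta> * norm x / \<sigma>\<bar> \<le> \<bar>x \<bullet> \<phi> ?y / \<sigma>\<bar>"
      using \<delta>(2)[OF True] \<delta>(1) sigma_pos by (simp add: abs_mult divide_right_mono)
    then have "(\<delta> * norm x / \<sigma>)\<^sup>2 \<le> (x \<bullet> \<phi> ?y / \<sigma>)\<^sup>2" by (simp only: abs_le_square_iff)
    then show ?thesis using True by simp
  qed simp
  then show ?case
    using Suc.IH unfolding prec cnt_Suc[OF \<omega>] by (simp add: distrib_left)
qed

text \<open>The direction \<open>x\<close> is quantified inside the almost sure statement because it
  will be the random estimation error; neither the null set nor the time threshold may depend on
  it.\<close>

lemma AE_prec_ge:
  assumes L: "Liminf at_top
      (\<lambda>l::real. ereal (measure lebesgue ({x. norm (\<phi> x) \<le> L} \<inter> {-l..l}) / l)) > 0"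
    and B: "B \<subseteq> {-R..R}" "0 < measure lborel B" and \<delta>: "0 < \<delta>"
  shows "\<exists>\<kappa>>0. AE \<omega> in M. eventually (\<lambda>t. \<forall>x. (\<forall>y\<in>B. \<delta> * norm x \<le> \<bar>x \<bullet> \<phi> y\<bar>) \<longrightarrow>
    \<kappa> * real t * (norm x)\<^sup>2 \<le> x \<bullet> (prec (S t \<omega>) *v x)) sequentially"
proof -
  obtain k where k: "k > 0" and ev: "AE \<omega> in M. eventually (\<lambda>t. k * real t \<le> cnt (S t \<omega>)) sequentially"
    using AE_cnt_ge[OF L B] by blast
  define \<kappa> where "\<kappa> = (\<delta> / \<sigma>)\<^sup>2 * k"
  have "\<kappa> > 0" using \<delta> k sigma_pos by (simp add: \<kappa>_def)
  moreover have "AE \<omega> in M. eventually (\<lambda>t. \<forall>x. (\<forall>y\<in>B. \<delta> * norm x \<le> \<bar>x \<bullet> \<phi> y\<bar>) \<longrightarrow>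
    \<kappa> * real t * (norm x)\<^sup>2 \<le> x \<bullet> (prec (S t \<omega>) *v x)) sequentially"
    using ev
  proof (rule AE_mp, intro AE_I2 impI)
    fix \<omega> assume \<omega>: "\<omega> \<in> space M"
      and "eventually (\<lambda>t. k * real t \<le> cnt (S t \<omega>)) sequentially"
    from this(2) show "eventually (\<lambda>t. \<forall>x. (\<forall>y\<in>B. \<delta> * norm x \<le> \<bar>x \<bullet> \<phi> y\<bar>) \<longrightarrow>
      \<kappa> * real t * (norm x)\<^sup>2 \<le> x \<bullet> (prec (S t \<omega>) *v x)) sequentially"
    proof eventually_elim
      case (elim t)
      show ?case
      proof (intro allI impI)
        fix x assume x: "\<forall>y\<in>B. \<delta> * norm x \<le> \<bar>x \<bullet> \<phi> y\<bar>"
        have "\<kappa> * real t * (norm x)\<^sup>2 = (\<delta> * norm x / \<sigma>)\<^sup>2 * (k * real t)"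
          by (simp add: \<kappa>_def power_mult_distrib power_divide)
        also have "\<dots> \<le> (\<delta> * norm x / \<sigma>)\<^sup>2 * cnt (S t \<omega>)"
          using elim by (rule mult_left_mono) simp
        also have "\<dots> \<le> x \<bullet> (prec (S t \<omega>) *v x)"
          using x \<delta> by (intro prec_ge_cnt[OF \<omega>]) auto
        finally show "\<kappa> * real t * (norm x)\<^sup>2 \<le> x \<bullet> (prec (S t \<omega>) *v x)" .
      qed
    qed
  qed
  ultimately show ?thesis by blast
qed

end

section \<open>The closed loop\<close>

text \<open>For each unit direction some output gives a nonzero product, and continuity keeps the
  product away from 0 on a neighbourhood of both. Finitely many neighbourhoods cover the sphere, and
  homogeneity extends the bound to all \<open>x\<close>.\<close>

lemma finite_excitation:
  fixes \<phi> :: "real \<Rightarrow> 'b::euclidean_space"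
  assumes E: "open E" and cont: "continuous_on E \<phi>"
    and indep: "\<And>x. (\<And>y. y \<in> E \<Longrightarrow> x \<bullet> \<phi> y = 0) \<Longrightarrow> x = 0"
  obtains \<B> \<delta> where "finite \<B>" "0 < \<delta>"
    "\<And>B. B \<in> \<B> \<Longrightarrow> open B \<and> bounded B \<and> B \<noteq> {}"
    "\<And>x. x \<noteq> 0 \<Longrightarrow> \<exists>B\<in>\<B>. \<forall>y\<in>B. \<delta> * norm x \<le> \<bar>x \<bullet> \<phi> y\<bar>"
proof -
  have "\<exists>U B d. open U \<and> x \<in> U \<and> open B \<and> bounded B \<and> B \<noteq> {} \<and> 0 < d \<and>
      (\<forall>x'\<in>U. \<forall>y\<in>B. d \<le> \<bar>x' \<bullet> \<phi> y\<bar>)" if "x \<in> sphere 0 1" for x :: 'b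
  proof -
    have "x \<noteq> 0" using that by auto
    then obtain y where y: "y \<in> E" "x \<bullet> \<phi> y \<noteq> 0" using indep by blast
    define d where "d = \<bar>x \<bullet> \<phi> y\<bar> / 2"
    have d: "d > 0" "d < \<bar>x \<bullet> \<phi> y\<bar>" using y by (auto simp: d_def)
    have "continuous_on (UNIV \<times> E) (\<lambda>z. \<bar>fst z \<bullet> \<phi> (snd z)\<bar>)"
      by (intro continuous_intros continuous_on_compose2[OF cont]) auto
    then have "open ((\<lambda>z. \<bar>fst z \<bullet> \<phi> (snd z)\<bar>) -` {d<..} \<inter> (UNIV \<times> E))"
      using E by (subst (asm) continuous_on_open_vimage) (auto intro: open_Times)
    moreover have "(x, y) \<in> (\<lambda>z. \<bar>fst z \<bullet> \<phi> (snd z)\<bar>) -` {d<..} \<inter> (UNIV \<times> E)"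
      using y d by auto
    ultimately obtain U V where UV: "open U" "open V" "(x, y) \<in> U \<times> V"
        "U \<times> V \<subseteq> (\<lambda>z. \<bar>fst z \<bullet> \<phi> (snd z)\<bar>) -` {d<..} \<inter> (UNIV \<times> E)"
      by (rule open_prod_elim)
    \<comment> \<open>Intersecting \<open>V\<close> with a ball makes the set of outputs
      bounded.\<close>
    show ?thesis
    proof (intro exI conjI ballI)
      show "open U" "x \<in> U" "open (V \<inter> ball y 1)" "0 < d" using UV d by auto
      show "bounded (V \<inter> ball y 1)" by (simp add: bounded_Int)
      show "V \<inter> ball y 1 \<noteq> {}" using UV(3) by (auto intro!: exI[of _ y])
      show "d \<le> \<bar>x' \<bullet> \<phi> z\<bar>" if "x' \<in> U" "z \<in> V \<inter> ball y 1" for x' z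
        using UV(4) that by fastforce
    qed
  qed
  then obtain U B d where U: "\<And>x. x \<in> sphere 0 1 \<Longrightarrow> open (U x) \<and> x \<in> U x"
    and B: "\<And>x. x \<in> sphere 0 1 \<Longrightarrow> open (B x) \<and> bounded (B x) \<and> B x \<noteq> {}"
    and d: "\<And>x. x \<in> sphere 0 1 \<Longrightarrow> 0 < d x"
    and ex: "\<And>x x' y. x \<in> sphere (0 :: 'b) 1 \<Longrightarrow> x' \<in> U x \<Longrightarrow> y \<in> B x \<Longrightarrow> d x \<le> \<bar>x' \<bullet> \<phi> y\<bar>"
    by metis
  have "compact (sphere (0 :: 'b) 1)" by simp
  then obtain T where T: "T \<subseteq> sphere 0 1" "finite T" "sphere 0 1 \<subseteq> (\<Union>x\<in>T. U x)"
    by (rule compactE_image[of _ "sphere 0 1" U]) (use U in auto)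
  \<comment> \<open>The inserted 1 ensures that the minimum is over a nonempty set.\<close>
  define \<delta> where "\<delta> = Min (insert 1 (d ` T))"
  show ?thesis
  proof
    show "finite (B ` T)" using T by simp
    show "0 < \<delta>" using T d by (auto simp: \<delta>_def)
    show "open B' \<and> bounded B' \<and> B' \<noteq> {}" if "B' \<in> B ` T" for B' using that T(1) B by auto
    fix x :: 'b assume x: "x \<noteq> 0"
    then have "x /\<^sub>R norm x \<in> sphere 0 1" by simp
    then obtain z where z: "z \<in> T" "x /\<^sub>R norm x \<in> U z" using T by blast
    have "\<delta> * norm x \<le> \<bar>x \<bullet> \<phi> y\<bar>" if "y \<in> B z" for y
    proof -
      have "\<delta> \<le> d z" using T z by (auto simp: \<delta>_def)
      also have "\<dots> \<le> \<bar>(x /\<^sub>R norm x) \<bullet> \<phi> y\<bar>" using z that T by (intro ex) auto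
      also have "\<dots> = \<bar>x \<bullet> \<phi> y\<bar> / norm x" by (simp add: abs_mult field_simps)
      finally show ?thesis using x by (simp add: field_simps)
    qed
    then show "\<exists>B'\<in>B ` T. \<forall>y\<in>B'. \<delta> * norm x \<le> \<bar>x \<bullet> \<phi> y\<bar>" using z by blast
  qed
qed

section \<open>Initial law and trajectories driven by the noise\<close>

definition init :: "real ^ 'n::finite \<Rightarrow> real \<Rightarrow> 'n lstate" where
  "init \<theta>0 y0 = (\<theta>0, mat 1, mat 1, y0, 0)"

lemma valid_init_state: "valid (init \<theta>0 y0)"
  by (simp add: valid_def init_def)

text \<open>The normalising constant of the prior need not be computed: total probability 1 forces
  it to be the inverse of the initial mass.\<close>

lemma (in prob_space) nn_integral_prior:
  fixes \<theta> :: "'a \<Rightarrow> real ^ 'n::finite"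
  assumes D: "distributed M lborel \<theta> (mvn_density \<theta>0)"
    and [measurable]: "case_prod g \<in> borel_measurable (borel \<Otimes>\<^sub>M borel)"
  shows "(\<integral>\<^sup>+\<omega>. g (\<theta> \<omega>) (init \<theta>0 y0) \<partial>M) = post g (init \<theta>0 y0)"
proof -
  let ?s = "init \<theta>0 y0"
  let ?C = "ennreal ((2 * pi) powr (- real CARD('n) / 2))"
  have mvn: "ennreal (mvn_density \<theta>0 x) = ?C * ennreal (dens ?s x)" for x
    by (simp add: mvn_density_def dens_def init_def power2_norm_eq_inner ennreal_mult)
  have int: "(\<integral>\<^sup>+\<omega>. f (\<theta> \<omega>) \<partial>M) = ?C * (\<integral>\<^sup>+x. f x * ennreal (dens ?s x) \<partial>lborel)"
    if [measurable]: "f \<in> borel_measurable borel" for f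
  proof -
    have "(\<integral>\<^sup>+\<omega>. f (\<theta> \<omega>) \<partial>M) = (\<integral>\<^sup>+x. ennreal (mvn_density \<theta>0 x) * f x \<partial>lborel)"
      by (rule distributed_nn_integral[OF D, symmetric]) simp
    also have "\<dots> = (\<integral>\<^sup>+x. ?C * (f x * ennreal (dens ?s x)) \<partial>lborel)"
      unfolding mvn by (simp only: mult_ac)
    also have "\<dots> = ?C * (\<integral>\<^sup>+x. f x * ennreal (dens ?s x) \<partial>lborel)"
      by (rule nn_integral_cmult) measurable
    finally show ?thesis .
  qed
  have C: "?C * mass ?s = 1"
    using int[of "\<lambda>_. 1"] by (simp add: mass_def emeasure_space_1)
  have "(\<integral>\<^sup>+\<omega>. g (\<theta> \<omega>) ?s \<partial>M) = ?C * (\<integral>\<^sup>+x. g x ?s * ennreal (dens ?s x) \<partial>lborel)"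
    by (rule int) measurable
  also have "\<dots> = ?C * (\<integral>\<^sup>+x. g x ?s * ennreal (dens ?s x) \<partial>lborel) * mass ?s / mass ?s"
    using mass_pos[of ?s] mass_finite[OF valid_init_state[of \<theta>0 y0]] by (simp add: ennreal_mult_divide_eq)
  also have "\<dots> = ?C * mass ?s * (\<integral>\<^sup>+x. g x ?s * ennreal (dens ?s x) \<partial>lborel) / mass ?s"
    by (simp only: mult_ac)
  finally show ?thesis unfolding C post_def by simp
qed

context ls_loop
begin

text \<open>The state as a deterministic function of parameter and noise, so that independence can
  be exploited. At time \<open>t\<close> it depends only on \<open>W 1\<close>, ...,
  \<open>W t\<close>, which leaves \<open>W (Suc t)\<close> fresh.\<close>

primrec traj :: "nat \<Rightarrow> 'n lstate \<Rightarrow> real ^ 'n \<Rightarrow> (nat \<Rightarrow> real) \<Rightarrow> 'n lstate" where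
  "traj 0 s x W = s"
| "traj (Suc t) s x W = step (traj t s x W)
    ((x - est (traj t s x W)) \<bullet> \<phi> (obs (traj t s x W)) + W (Suc t))"

lemma traj_measurable [measurable]:
  "case_prod (traj t s) \<in> borel \<Otimes>\<^sub>M PiM {1..} (\<lambda>_. borel) \<rightarrow>\<^sub>M borel"
proof (induction t)
  case (Suc t)
  note [measurable] = Suc
  show ?case unfolding traj.simps by measurable
qed simp

lemma traj_fun_upd: "t < i \<Longrightarrow> traj t s x (W(i := v)) = traj t s x W"
  by (induction t) auto

lemma ls_process_traj:
  fixes M :: "'a measure" and w :: "nat \<Rightarrow> 'a \<Rightarrow> real"
  assumes M: "prob_space M"
    and indep: "prob_space.indep_vars M (\<lambda>_. borel) w {1..}"
    and w: "\<And>t. t \<ge> 1 \<Longrightarrow> distributed M lborel (w t) (normal_density 0 \<sigma>)"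
    and \<theta>: "distributed M lborel \<theta> (mvn_density \<theta>0)"
    and ind: "indep_rv M borel \<theta> (PiM {1..} (\<lambda>_. borel)) (\<lambda>\<omega>. \<lambda>t\<in>{1..}. w t \<omega>)"
  shows "ls_process \<phi> \<sigma> B M \<theta> (\<lambda>t \<omega>. traj t (init \<theta>0 y0) (\<theta> \<omega>) (\<lambda>j\<in>{1..}. w j \<omega>))"
proof -
  interpret prob_space M by (rule M)
  let ?W = "\<lambda>\<omega>. \<lambda>j\<in>{1..}. w j \<omega>" and ?s = "init \<theta>0 y0"
  have [measurable]: "\<theta> \<in> borel_measurable M" "?W \<in> measurable M (PiM {1..} (\<lambda>_. borel))"
    using ind by (auto simp: indep_rv_def)
  show ?thesis
  proof unfold_locales
    show "\<theta> \<in> borel_measurable M" by measurable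
    show "(\<lambda>\<omega>. traj t ?s (\<theta> \<omega>) (?W \<omega>)) \<in> borel_measurable M" for t
    proof -
      have "(\<lambda>\<omega>. (\<theta> \<omega>, ?W \<omega>)) \<in> M \<rightarrow>\<^sub>M borel \<Otimes>\<^sub>M PiM {1..} (\<lambda>_. borel)" by measurable
      from measurable_compose[OF this traj_measurable] show ?thesis by (simp only: prod.case)
    qed
    show "valid (traj 0 ?s (\<theta> \<omega>) (?W \<omega>))" for \<omega> by (simp add: valid_init_state)
    show "cnt (traj 0 ?s (\<theta> \<omega>) (?W \<omega>)) = 0" for \<omega> by (simp add: init_def)
    show "\<exists>y. traj (Suc t) ?s (\<theta> \<omega>) (?W \<omega>) = step (traj t ?s (\<theta> \<omega>) (?W \<omega>)) y" for t \<omega> by auto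
  next
    fix g :: "real ^ 'n \<Rightarrow> 'n lstate \<Rightarrow> ennreal"
    assume g: "case_prod g \<in> borel_measurable (borel \<Otimes>\<^sub>M borel)"
    show "(\<integral>\<^sup>+\<omega>. g (\<theta> \<omega>) (traj 0 ?s (\<theta> \<omega>) (?W \<omega>)) \<partial>M) =
        (\<integral>\<^sup>+\<omega>. post g (traj 0 ?s (\<theta> \<omega>) (?W \<omega>)) \<partial>M)"
      by (simp add: nn_integral_prior[OF \<theta> g] emeasure_space_1)
  next
    fix g :: "real ^ 'n \<Rightarrow> 'n lstate \<Rightarrow> ennreal" and t
    assume g [measurable]: "case_prod g \<in> borel_measurable (borel \<Otimes>\<^sub>M borel)"
    let ?T = "\<lambda>\<omega>. traj t ?s (\<theta> \<omega>) (?W \<omega>)"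
    let ?c = "\<lambda>x S. (x - est S) \<bullet> \<phi> (obs S)"
    \<comment> \<open>\<open>F\<close> gathers all that is determined before the new noise variable,
      including the parameter; \<open>h\<close> then performs the step.\<close>
    define F where "F = (\<lambda>x W. (x, traj t ?s x W))"
    define h where "h = (\<lambda>z v. g (fst z) (step (snd z) (?c (fst z) (snd z) + v)))"
    have [measurable]: "case_prod F \<in> borel \<Otimes>\<^sub>M PiM {1..} (\<lambda>_. borel) \<rightarrow>\<^sub>M borel \<Otimes>\<^sub>M borel"
      unfolding F_def by measurable
    have [measurable]: "case_prod h \<in> borel_measurable ((borel \<Otimes>\<^sub>M borel) \<Otimes>\<^sub>M borel)"
      unfolding h_def by measurable
    have "(\<integral>\<^sup>+\<omega>. g (\<theta> \<omega>) (traj (Suc t) ?s (\<theta> \<omega>) (?W \<omega>)) \<partial>M) =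
        (\<integral>\<^sup>+\<omega>. h (F (\<theta> \<omega>) (?W \<omega>)) (w (Suc t) \<omega>) \<partial>M)"
      by (simp add: h_def F_def)
    also have "\<dots> = (\<integral>\<^sup>+\<omega>. (\<integral>\<^sup>+v. h (F (\<theta> \<omega>) (?W \<omega>)) v * ennreal (normal_density 0 \<sigma> v) \<partial>lborel) \<partial>M)"
      by (rule nn_integral_fresh_coordinate[OF indep _ w ind])
        (measurable, auto simp: F_def traj_fun_upd simp del: fun_upd_apply)
    \<comment> \<open>The substitution \<open>v = y - c\<close>, with \<open>c\<close> the mean of
      the next output, turns the noise density into the output density.\<close>
    also have "\<dots> = (\<integral>\<^sup>+\<omega>. (\<integral>\<^sup>+y. g (\<theta> \<omega>) (step (?T \<omega>) y) *
        ennreal (normal_density 0 \<sigma> (y - ?c (\<theta> \<omega>) (?T \<omega>))) \<partial>lborel) \<partial>M)"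
    proof (rule nn_integral_cong)
      fix \<omega>
      show "(\<integral>\<^sup>+v. h (F (\<theta> \<omega>) (?W \<omega>)) v * ennreal (normal_density 0 \<sigma> v) \<partial>lborel) =
          (\<integral>\<^sup>+y. g (\<theta> \<omega>) (step (?T \<omega>) y) *
            ennreal (normal_density 0 \<sigma> (y - ?c (\<theta> \<omega>) (?T \<omega>))) \<partial>lborel)"
        using nn_integral_lborel_translate[of "\<lambda>v. g (\<theta> \<omega>) (step (?T \<omega>) (?c (\<theta> \<omega>) (?T \<omega>) + v)) *
          ennreal (normal_density 0 \<sigma> v)" "?c (\<theta> \<omega>) (?T \<omega>)"]
        by (simp add: h_def F_def)
    qed
    finally show "(\<integral>\<^sup>+\<omega>. g (\<theta> \<omega>) (traj (Suc t) ?s (\<theta> \<omega>) (?W \<omega>)) \<partial>M) =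
      (\<integral>\<^sup>+\<omega>. (\<integral>\<^sup>+y. g (\<theta> \<omega>) (step (?T \<omega>) y) *
        ennreal (normal_density 0 \<sigma> (y - ?c (\<theta> \<omega>) (?T \<omega>))) \<partial>lborel) \<partial>M)" .
  qed
qed

end

section \<open>Convergence rate and strong consistency\<close>

lemma C_k_on_imp_continuous_on: "C_k_on k E f \<Longrightarrow> continuous_on E f"
proof (cases k)
  case (Suc m)
  assume "C_k_on k E f"
  then have "(deriv ^^ 0) f differentiable (at x)" if "x \<in> E" for x
    using that Suc unfolding C_k_on_def by blast
  then show ?thesis
    by (auto intro!: continuous_at_imp_continuous_on differentiable_imp_continuous_within)
qed (simp add: C_k_on_def)

text \<open>The two bounds give the order \<open>ln t / t\<close>, which is then weakened to the
  stated rate.\<close>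

lemma rate_of_quadratic_bounds:
  fixes e :: "nat \<Rightarrow> 'b::real_normed_vector" and q :: "nat \<Rightarrow> real"
  assumes "\<kappa> > 0" and "eventually (\<lambda>t. q t \<le> 8 * ln (real t + 1)) sequentially"
    and "eventually (\<lambda>t. \<kappa> * real t * (norm (e t))\<^sup>2 \<le> q t) sequentially"
  shows "e \<longlonglongrightarrow> 0" "(\<lambda>t. (norm (e t))\<^sup>2) \<in> O(\<lambda>t. real t powr (- 1 / 2))"
proof -
  have "eventually (\<lambda>t. norm ((norm (e t))\<^sup>2) \<le> 8 / \<kappa> * norm (ln (real t + 1) / real t)) sequentially"
    using assms(2,3) eventually_gt_at_top[of 0]
  proof eventually_elim
    case (elim t)
    then have "\<kappa> * real t * (norm (e t))\<^sup>2 \<le> 8 * ln (real t + 1)" by linarith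
    then show ?case using elim(3) assms(1) by (simp add: field_simps)
  qed
  then have "(\<lambda>t. (norm (e t))\<^sup>2) \<in> O(\<lambda>t. ln (real t + 1) / real t)"
    by (rule bigoI)
  also have "(\<lambda>t. ln (real t + 1) / real t) \<in> O(\<lambda>t. real t powr (- 1 / 2))"
    by real_asymp
  finally show O: "(\<lambda>t. (norm (e t))\<^sup>2) \<in> O(\<lambda>t. real t powr (- 1 / 2))" .
  have "(\<lambda>t. real t powr (- 1 / 2)) \<in> o(\<lambda>_. 1)" by real_asymp
  from landau_o.big_small_trans[OF O this] have "(\<lambda>t. (norm (e t))\<^sup>2) \<longlonglongrightarrow> 0"
    by (auto dest: smalloD_tendsto)
  then have "(\<lambda>t. sqrt ((norm (e t))\<^sup>2)) \<longlonglongrightarrow> sqrt 0" by (rule tendsto_real_sqrt)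
  then show "e \<longlonglongrightarrow> 0" by (simp add: tendsto_norm_zero_iff)
qed

theorem theorem3p2:
  fixes M :: "'a measure"
    and \<theta> :: "'a \<Rightarrow> real ^ 'n::finite"
    and \<theta>0 :: "real ^ 'n"
    and w :: "nat \<Rightarrow> 'a \<Rightarrow> real"
    and \<sigma> y0 :: real
    and \<phi> :: "real \<Rightarrow> real ^ 'n"
    and E :: "real set"
    and y u :: "nat \<Rightarrow> 'a \<Rightarrow> real"
    and \<theta>hat :: "nat \<Rightarrow> 'a \<Rightarrow> real ^ 'n"
    and P :: "nat \<Rightarrow> 'a \<Rightarrow> real ^ 'n ^ 'n"
  assumes "prob_space M"
    and "CARD('n) \<ge> 2"
    and "\<phi> \<in> borel_measurable borel"
    and "open E"
    and "\<And>j. C_k_on CARD('n) E (\<lambda>x. \<phi> x $ j)"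
    \<comment> \<open>A1\<close>
    and "\<sigma> > 0"
    and "prob_space.indep_vars M (\<lambda>_. borel) w {1..}"
    and "\<And>t. t \<ge> 1 \<Longrightarrow> distributed M lborel (w t) (normal_density 0 \<sigma>)"
    \<comment> \<open>A2\<close>
    and "distributed M lborel \<theta> (mvn_density \<theta>0)"
    and "indep_rv M borel \<theta> (PiM {1..} (\<lambda>_. borel)) (\<lambda>\<omega>. \<lambda>t\<in>{1..}. w t \<omega>)"
    \<comment> \<open>A3\<close>
    and "lin_indep_on E (\<lambda>j x. \<phi> x $ j)"
    \<comment> \<open>the closed-loop system\<close>
    and "\<And>\<omega>. \<omega> \<in> space M \<Longrightarrow> y 0 \<omega> = y0"
    and "\<And>t \<omega>. \<omega> \<in> space M \<Longrightarrow>
           y (Suc t) \<omega> = \<theta> \<omega> \<bullet> \<phi> (y t \<omega>) + u t \<omega> + w (Suc t) \<omega>"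
    and "\<And>t \<omega>. \<omega> \<in> space M \<Longrightarrow> u t \<omega> = - (\<theta>hat t \<omega> \<bullet> \<phi> (y t \<omega>))"
    and "\<And>\<omega>. \<omega> \<in> space M \<Longrightarrow> \<theta>hat 0 \<omega> = \<theta>0"
    and "\<And>\<omega>. \<omega> \<in> space M \<Longrightarrow> P 0 \<omega> = mat 1"
    and "\<And>t \<omega>. \<omega> \<in> space M \<Longrightarrow>
           \<theta>hat (Suc t) \<omega> = \<theta>hat t \<omega> +
             (1 / \<sigma>\<^sup>2 * (y (Suc t) \<omega> - u t \<omega> - \<phi> (y t \<omega>) \<bullet> \<theta>hat t \<omega>)) *\<^sub>R
               (P (Suc t) \<omega> *v \<phi> (y t \<omega>))"
    and "\<And>t \<omega>. \<omega> \<in> space M \<Longrightarrow>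
           P (Suc t) \<omega> = P t \<omega> -
             (1 / (\<sigma>\<^sup>2 + \<phi> (y t \<omega>) \<bullet> (P t \<omega> *v \<phi> (y t \<omega>)))) *\<^sub>R
               (P t \<omega> ** outer_prod (\<phi> (y t \<omega>)) (\<phi> (y t \<omega>)) ** P t \<omega>)"
    \<comment> \<open>(i)\<close>
    and "\<exists>k1>0. \<exists>k2>0. \<forall>x. norm (\<phi> x) \<le> k1 * exp (k2 * \<bar>x\<bar>)"
    \<comment> \<open>(ii)\<close>
    and "\<exists>L>0. Liminf at_top
           (\<lambda>l::real. ereal (measure lebesgue ({x. norm (\<phi> x) \<le> L} \<inter> {-l..l}) / l)) > 0"
  shows "AE \<omega> in M. (\<lambda>t. \<theta>hat t \<omega>) \<longlonglongrightarrow> \<theta> \<omega> \<and>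
           (\<lambda>t. (norm (\<theta>hat t \<omega> - \<theta> \<omega>))\<^sup>2) \<in> O(\<lambda>t. real t powr (-1/2))"
proof -
  note loop = assms(12-18)
  interpret M: prob_space M by (rule assms(1))
  let ?W = "\<lambda>\<omega>. \<lambda>j\<in>{1..}. w j \<omega>" and ?s = "init \<theta>0 y0"
  obtain L where L: "Liminf at_top
      (\<lambda>l::real. ereal (measure lebesgue ({x. norm (\<phi> x) \<le> L} \<inter> {-l..l}) / l)) > 0"
    using assms(20) by blast
  have cont: "continuous_on E \<phi>"
    using assms(5) by (intro continuous_on_vec_lambda[of E "\<lambda>j x. \<phi> x $ j", simplified vec_nth_inverse vec_lambda_eta])
      (rule C_k_on_imp_continuous_on)
  \<comment> \<open>A3 says that no nonzero direction is orthogonal to all regressors from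
    \<open>E\<close>.\<close>
  have "x = 0" if "\<And>y. y \<in> E \<Longrightarrow> x \<bullet> \<phi> y = 0" for x
    using assms(11) that unfolding lin_indep_on_def inner_vec_def by (simp add: vec_eq_iff)
  then obtain \<B> \<delta> where \<B>: "finite \<B>" "0 < \<delta>"
    "\<And>B. B \<in> \<B> \<Longrightarrow> open B \<and> bounded B \<and> B \<noteq> {}"
    "\<And>x. x \<noteq> 0 \<Longrightarrow> \<exists>B\<in>\<B>. \<forall>y\<in>B. \<delta> * norm x \<le> \<bar>x \<bullet> \<phi> y\<bar>"
    using finite_excitation[OF assms(4) cont] by blast
  \<comment> \<open>The precision along the given loop. It does not involve \<open>B\<close>, so the
    bounds from the different sets concern one and the same matrix.\<close>
  define Q where "Q = (\<lambda>t \<omega>. mat 1 + (\<Sum>i<t. (1 / \<sigma>\<^sup>2) *\<^sub>R outer_prod (\<phi> (y i \<omega>)) (\<phi> (y i \<omega>))))"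
  have loopB: "ls_loop \<phi> \<sigma> B" if "B \<in> sets borel" for B
    using that assms(3,6) by unfold_locales
  have proc: "ls_process \<phi> \<sigma> B M \<theta> (\<lambda>t \<omega>. ls_loop.traj \<phi> \<sigma> B t ?s (\<theta> \<omega>) (?W \<omega>))"
    if "B \<in> sets borel" for B
    by (rule ls_loop.ls_process_traj[OF loopB[OF that] assms(1,7,8,9,10)])
  have state: "ls_loop.traj \<phi> \<sigma> B t ?s (\<theta> \<omega>) (?W \<omega>) =
      (\<theta>hat t \<omega>, P t \<omega>, Q t \<omega>, y t \<omega>, (\<Sum>i<t. indicator B (y i \<omega>)))"
    if B: "B \<in> sets borel" and \<omega>: "\<omega> \<in> space M" for B t \<omega>
  proof -
    interpret ls_loop \<phi> \<sigma> B by (rule loopB[OF B])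
    show ?thesis
    proof (induction t)
      case 0
      then show ?case using loop(1,4,5)[OF \<omega>] by (simp add: init_def Q_def)
    next
      case (Suc t)
      have y: "(\<theta> \<omega> - \<theta>hat t \<omega>) \<bullet> \<phi> (y t \<omega>) + w (Suc t) \<omega> = y (Suc t) \<omega>"
        using loop(2,3)[OF \<omega>, of t] by (simp add: inner_diff_left)
      \<comment> \<open>The control reduces the innovation to the output, as built into
        \<open>step\<close>.\<close>
      have innov: "y (Suc t) \<omega> - u t \<omega> - \<phi> (y t \<omega>) \<bullet> \<theta>hat t \<omega> = y (Suc t) \<omega>"
        using loop(3)[OF \<omega>, of t] by (simp add: inner_commute)
      have "traj (Suc t) ?s (\<theta> \<omega>) (?W \<omega>) = step
          (\<theta>hat t \<omega>, P t \<omega>, Q t \<omega>, y t \<omega>, (\<Sum>i<t. indicator B (y i \<omega>))) (y (Suc t) \<omega>)"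
        using y by (simp only: traj.simps Suc.IH lstate_sel) simp
      also have "\<dots> = (\<theta>hat (Suc t) \<omega>, P (Suc t) \<omega>, Q (Suc t) \<omega>, y (Suc t) \<omega>,
          (\<Sum>i<Suc t. indicator B (y i \<omega>)))"
        using loop(6)[OF \<omega>, of t] loop(7)[OF \<omega>, of t]
        by (simp add: step_def cov_upd_def innov_var_def innov Q_def)
      finally show ?case .
    qed
  qed
  \<comment> \<open>The error form does not involve visits, so the process may be taken with the
    empty set.\<close>
  have err: "AE \<omega> in M. eventually (\<lambda>t. (\<theta> \<omega> - \<theta>hat t \<omega>) \<bullet> (Q t \<omega> *v (\<theta> \<omega> - \<theta>hat t \<omega>)) \<le>
      8 * ln (real t + 1)) sequentially"
    using ls_process.AE_err_le[OF proc[of "{}"]]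
    by (rule AE_mp) (auto intro!: AE_I2 simp: ls_process.err_def[OF proc[of "{}"]] state
        simp del: One_nat_def)
  have "\<exists>\<kappa>>0. AE \<omega> in M. eventually (\<lambda>t. \<forall>x. (\<forall>y\<in>B. \<delta> * norm x \<le> \<bar>x \<bullet> \<phi> y\<bar>) \<longrightarrow>
      \<kappa> * real t * (norm x)\<^sup>2 \<le> x \<bullet> (Q t \<omega> *v x)) sequentially" if "B \<in> \<B>" for B
  proof -
    have B: "open B" "bounded B" "B \<noteq> {}" using \<B>(3)[OF that] by auto
    then have Bs: "B \<in> sets borel" by simp
    obtain R where R: "B \<subseteq> {-R..R}"
      using B(2) by (auto simp: bounded_iff abs_le_iff subset_iff minus_le_iff)
    have "emeasure lborel B \<le> emeasure lborel {-R..R}" using R by (intro emeasure_mono) auto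
    then have "emeasure lborel B < \<infinity>" by (auto simp: emeasure_lborel_Icc_eq intro: le_less_trans)
    moreover have "0 < emeasure lborel B"
    proof -
      obtain z e where "0 < e" "cball z e \<subseteq> B"
        using B(1,3) unfolding open_contains_cball by blast
      then have "emeasure lborel {z - e..z + e} \<le> emeasure lborel B"
        using Bs by (intro emeasure_mono) (auto simp: cball_eq_atLeastAtMost)
      with \<open>0 < e\<close> show ?thesis by (simp add: less_le_trans[rotated])
    qed
    ultimately have "0 < measure lborel B" by (simp add: measure_def enn2real_positive_iff)
    from ls_process.AE_prec_ge[OF proc[OF Bs] L R this \<B>(2)]
    obtain \<kappa> where \<kappa>: "\<kappa> > 0" and ae: "AE \<omega> in M. eventually (\<lambda>t. \<forall>x. (\<forall>y\<in>B. \<delta> * norm x \<le> \<bar>x \<bullet> \<phi> y\<bar>) \<longrightarrow>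
      \<kappa> * real t * (norm x)\<^sup>2 \<le> x \<bullet> (prec (ls_loop.traj \<phi> \<sigma> B t ?s (\<theta> \<omega>) (?W \<omega>)) *v x)) sequentially"
      by blast
    have prec: "prec (ls_loop.traj \<phi> \<sigma> B t ?s (\<theta> \<omega>) (?W \<omega>)) = Q t \<omega>" if "\<omega> \<in> space M" for t \<omega>
      by (simp only: state[OF Bs that] lstate_sel)
    have "AE \<omega> in M. eventually (\<lambda>t. \<forall>x. (\<forall>y\<in>B. \<delta> * norm x \<le> \<bar>x \<bullet> \<phi> y\<bar>) \<longrightarrow>
      \<kappa> * real t * (norm x)\<^sup>2 \<le> x \<bullet> (Q t \<omega> *v x)) sequentially"
      using ae by (rule AE_mp) (rule AE_I2, simp only: prec simp_thms)
    with \<kappa> show ?thesis by blast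
  qed
  then have "\<forall>B\<in>\<B>. \<exists>\<kappa>>0. AE \<omega> in M. eventually (\<lambda>t. \<forall>x. (\<forall>y\<in>B. \<delta> * norm x \<le> \<bar>x \<bullet> \<phi> y\<bar>) \<longrightarrow>
      \<kappa> * real t * (norm x)\<^sup>2 \<le> x \<bullet> (Q t \<omega> *v x)) sequentially"
    by (rule ballI)
  from bchoice[OF this] obtain K where K: "\<forall>B\<in>\<B>. K B > 0"
    "\<forall>B\<in>\<B>. AE \<omega> in M. eventually (\<lambda>t. \<forall>x. (\<forall>y\<in>B. \<delta> * norm x \<le> \<bar>x \<bullet> \<phi> y\<bar>) \<longrightarrow>
      K B * real t * (norm x)\<^sup>2 \<le> x \<bullet> (Q t \<omega> *v x)) sequentially"
    by blast
  \<comment> \<open>One constant for the finite family of sets; the inserted 1 keeps the minimum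
    well defined.\<close>
  define \<kappa> where "\<kappa> = Min (insert 1 (K ` \<B>))"
  have \<kappa>: "\<kappa> > 0" using \<B>(1) K(1) by (simp add: \<kappa>_def)
  have "AE \<omega> in M. \<forall>B\<in>\<B>. eventually (\<lambda>t. \<forall>x. (\<forall>y\<in>B. \<delta> * norm x \<le> \<bar>x \<bullet> \<phi> y\<bar>) \<longrightarrow>
      K B * real t * (norm x)\<^sup>2 \<le> x \<bullet> (Q t \<omega> *v x)) sequentially"
    using K(2) \<B>(1) by (intro AE_finite_allI) auto
  with err show ?thesis
  proof eventually_elim
    case (elim \<omega>)
    have "eventually (\<lambda>t. \<forall>B\<in>\<B>. \<forall>x. (\<forall>y\<in>B. \<delta> * norm x \<le> \<bar>x \<bullet> \<phi> y\<bar>) \<longrightarrow>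
      K B * real t * (norm x)\<^sup>2 \<le> x \<bullet> (Q t \<omega> *v x)) sequentially"
      using elim(2) \<B>(1) by (intro eventually_ball_finite) auto
    then have low: "eventually (\<lambda>t. \<kappa> * real t * (norm (\<theta> \<omega> - \<theta>hat t \<omega>))\<^sup>2 \<le>
        (\<theta> \<omega> - \<theta>hat t \<omega>) \<bullet> (Q t \<omega> *v (\<theta> \<omega> - \<theta>hat t \<omega>))) sequentially"
    proof eventually_elim
      case (elim t)
      let ?e = "\<theta> \<omega> - \<theta>hat t \<omega>"
      show ?case
      proof (cases "?e = 0")
        case False
        \<comment> \<open>The set is picked to suit the current error, hence depends on
          \<open>\<omega>\<close> and \<open>t\<close>; this is allowed because the bounds hold for
          all sets and all directions simultaneously.\<close>
        then obtain B where B: "B \<in> \<B>" "\<forall>y\<in>B. \<delta> * norm ?e \<le> \<bar>?e \<bullet> \<phi> y\<bar>" using \<B>(4) by blast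
        have "\<kappa> \<le> K B" using B(1) \<B>(1) by (simp add: \<kappa>_def)
        then have "\<kappa> * (real t * (norm ?e)\<^sup>2) \<le> K B * (real t * (norm ?e)\<^sup>2)"
          by (intro mult_right_mono) auto
        also have "\<dots> \<le> ?e \<bullet> (Q t \<omega> *v ?e)" using elim B by (auto simp: mult.assoc)
        finally show ?thesis by (simp add: mult.assoc)
      qed simp
    qed
    note rate = rate_of_quadratic_bounds[OF \<kappa> elim(1) low]
    have "(\<lambda>t. \<theta>hat t \<omega> - \<theta> \<omega>) \<longlonglongrightarrow> 0"
      using tendsto_minus[OF rate(1)] by simp
    then show ?case using rate(2) by (simp add: LIM_zero_iff norm_minus_commute)
  qed
qed

end
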